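(* Let $m>0$ and $\alpha>0$. Let $\psi\in F^2_{\alpha,m}(\mathbb C)$ and let $\phi$ be an entire function on $\mathbb C$. Then $C_{\psi,\phi}$ is Hilbert-Schmidt on $F^2_{\alpha,m}(\mathbb C)$ if and only if $$\int_{\mathbb C}|\psi(z)|^2|\phi(z)|^{m-2}e^{\alpha(|\phi(z)|^m-|z|^m)}\,dA(z)<\infty.$$
   Context: For $m>0$ and $\alpha>0$, the weighted Fock space $F^2_{\alpha,m}(\mathbb C)$ is the Hilbert space of all entire functions on $\mathbb C$ that are square integrable with respect to the measure $d\mu_{\alpha,m}(z)=\frac{m\alpha^{2/m}}{2\pi\Gamma(2/m)}e^{-\alpha|z|^m}\,dA(z)$, where $dA$ is Lebesgue measure on $\mathbb C$ and $\Gamma$ is the Euler gamma function; its inner product is $\langle f,g\rangle_{\alpha,m}=\int_{\mathbb C} f\overline{g}\,d\mu_{\alpha,m}$ and its norm is $\|\cdot\|_{\alpha,m}$. For entire functions $\psi$ and $\phi$, the weighted composition operator is $C_{\psi,\phi}f=\psi\cdot(f\circ\phi)$. Saying that it is Hilbert-Schmidt on $F^2_{\alpha,m}(\mathbb C)$ means that it maps $F^2_{\alpha,m}(\mathbb C)$ into itself and is a Hilbert-Schmidt operator there.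
   Formalization: At zeros of φ the factor |φ(z)|^{m-2} is taken to be 0; this matters only for φ ≡ 0 with m < 2, where the integrand is otherwise undefined or infinite although C_{ψ,0} has rank at most one and so is Hilbert-Schmidt. *)

theory Defs
  imports "HOL-Complex_Analysis.Complex_Analysis"
begin

definition fock_measure :: "real \<Rightarrow> real \<Rightarrow> complex measure" where
  "fock_measure \<alpha> m = density lborel
     (\<lambda>z. ennreal (m * \<alpha> powr (2 / m) / (2 * pi * Gamma (2 / m)) * exp (- \<alpha> * cmod z powr m)))"

text \<open>The elements are honest entire functions rather than classes modulo null sets, so
  \<open>fock_norm\<close> below is definite on this set.\<close>

definition fock_space :: "real \<Rightarrow> real \<Rightarrow> (complex \<Rightarrow> complex) set" where
  "fock_space \<alpha> m =
     {f. f holomorphic_on UNIV \<and> integrable (fock_measure \<alpha> m) (\<lambda>z. (cmod (f z))\<^sup>2)}"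

definition fock_inner ::
  "real \<Rightarrow> real \<Rightarrow> (complex \<Rightarrow> complex) \<Rightarrow> (complex \<Rightarrow> complex) \<Rightarrow> complex" where
  "fock_inner \<alpha> m f g = (LINT z|fock_measure \<alpha> m. f z * cnj (g z))"

definition fock_norm :: "real \<Rightarrow> real \<Rightarrow> (complex \<Rightarrow> complex) \<Rightarrow> real" where
  "fock_norm \<alpha> m f = sqrt (LINT z|fock_measure \<alpha> m. (cmod (f z))\<^sup>2)"

definition weighted_comp ::
  "(complex \<Rightarrow> complex) \<Rightarrow> (complex \<Rightarrow> complex) \<Rightarrow> (complex \<Rightarrow> complex) \<Rightarrow> complex \<Rightarrow> complex" where
  "weighted_comp \<psi> \<phi> f = (\<lambda>z. \<psi> z * f (\<phi> z))"

definition fock_bounded_operator ::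
  "real \<Rightarrow> real \<Rightarrow> ((complex \<Rightarrow> complex) \<Rightarrow> complex \<Rightarrow> complex) \<Rightarrow> bool" where
  "fock_bounded_operator \<alpha> m T \<longleftrightarrow>
     (\<forall>f\<in>fock_space \<alpha> m. T f \<in> fock_space \<alpha> m) \<and>
     (\<forall>f\<in>fock_space \<alpha> m. \<forall>g\<in>fock_space \<alpha> m. \<forall>a b.
        T (\<lambda>z. a * f z + b * g z) = (\<lambda>z. a * T f z + b * T g z)) \<and>
     (\<exists>C. \<forall>f\<in>fock_space \<alpha> m. fock_norm \<alpha> m (T f) \<le> C * fock_norm \<alpha> m f)"

text \<open>Orthonormal with dense linear span. The space is separable and infinite-dimensional, so
  indexing by \<^typ>\<open>nat\<close> loses no orthonormal basis.\<close>

definition fock_onb :: "real \<Rightarrow> real \<Rightarrow> (nat \<Rightarrow> complex \<Rightarrow> complex) \<Rightarrow> bool" where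
  "fock_onb \<alpha> m e \<longleftrightarrow>
     (\<forall>n. e n \<in> fock_space \<alpha> m) \<and>
     (\<forall>i j. fock_inner \<alpha> m (e i) (e j) = (if i = j then 1 else 0)) \<and>
     (\<forall>f\<in>fock_space \<alpha> m. \<forall>\<epsilon>>0. \<exists>N c.
        fock_norm \<alpha> m (\<lambda>z. f z - (\<Sum>n<N. c n * e n z)) < \<epsilon>)"

definition fock_hilbert_schmidt ::
  "real \<Rightarrow> real \<Rightarrow> ((complex \<Rightarrow> complex) \<Rightarrow> complex \<Rightarrow> complex) \<Rightarrow> bool" where
  "fock_hilbert_schmidt \<alpha> m T \<longleftrightarrow>
     fock_bounded_operator \<alpha> m T \<and>
     (\<exists>e. fock_onb \<alpha> m e \<and> summable (\<lambda>n. (fock_norm \<alpha> m (T (e n)))\<^sup>2))"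

text \<open>
  Pitfall: the library has \<open>0 powr a = 0\<close> for every \<open>a\<close>. In an integrand containing
  \<open>cmod (\<phi> z) powr (m - 2)\<close> with \<open>\<phi>\<close> entire this concerns only the zeros of \<open>\<phi>\<close>, a null set
  unless \<open>\<phi>\<close> vanishes identically.
\<close>

end

theory Submission imports Defs begin

text \<open>
Write \<open>\<mu>\<close> for the Gaussian-type probability measure of the space and \<open>c\<^sub>n\<close> for the squared norm of
\<open>z\<^sup>n\<close>. Polar integration gives \<open>c\<^sub>n\<close> as a quotient of Gamma values, and since \<open>\<mu>\<close> is invariant under
rotations the monomials are orthogonal; so the squared norm of an entire function with Taylor
coefficients \<open>a\<^sub>n\<close> is the sum of \<open>|a\<^sub>n|\<^sup>2 c\<^sub>n\<close> (\<open>sq_norm_power_series\<close>). By the Cauchy-Schwarz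
inequality, \<open>|f w|\<^sup>2\<close> is at most the squared norm of \<open>f\<close> times \<open>K(|w|)\<close>, where \<open>K(x)\<close> is the sum of
\<open>x\<^bsup>2n\<^esup> / c\<^sub>n\<close>, the reproducing kernel on the diagonal.

For an orthonormal basis \<open>e\<^sub>n\<close>, the sum of \<open>|e\<^sub>n w|\<^sup>2\<close> is comparable to \<open>K(|w|)\<close>. Multiplying by
\<open>|\<psi>|\<^sup>2\<close>, substituting \<open>w = \<phi> z\<close> and integrating shows that the weighted composition operator is
Hilbert-Schmidt exactly when the integral of \<open>|\<psi>|\<^sup>2 K(|\<phi>|)\<close> against \<open>\<mu>\<close> is finite
(\<open>hilbert_schmidt_if_hs_integral_finite\<close>, \<open>hs_integral_finite_if_hilbert_schmidt\<close>).

It remains to replace \<open>K(x)\<close> by its growth \<open>x\<^bsup>m-2\<^esup> exp (\<alpha> x\<^sup>m)\<close>. With \<open>t = \<alpha> x\<^sup>m\<close> and \<open>b = 2/m\<close>, the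
kernel is, up to an explicit factor, the sum of \<open>t\<^bsup>bn-1\<^esup> / \<Gamma>(bn)\<close> over \<open>n \<ge> 1\<close>. The function
\<open>t\<^bsup>s-1\<^esup> / \<Gamma>(s)\<close> of \<open>s\<close> varies so regularly that its sums along any two arithmetic progressions are
comparable for \<open>t \<ge> 1\<close>, and along the integers the sum is \<open>exp t\<close> (\<open>suminf_gamma_weight_exp\<close>).

This comparison says nothing about small \<open>x\<close>, where for \<open>m < 2\<close> the growth function is unbounded
while the kernel is not: a zero of \<open>\<phi>\<close> of high order could make the stated integral diverge near
that zero. Such zeros do not occur. If the integral with the kernel is finite and \<open>\<psi>\<close> is not
identically zero, then \<open>|\<psi>|\<^sup>2 K(|\<phi>|)\<close> is pointwise at most a constant times \<open>K(|z|)\<close>, and this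
forces \<open>\<phi> z = b + a z\<close> (\<open>entire_affine_of_exp_bound\<close>). For \<open>a \<noteq> 0\<close> the only zero is simple and
\<open>|b + a z|\<^bsup>m-2\<^esup>\<close> is locally integrable because \<open>m > 0\<close>; for \<open>a = 0\<close> the growth function contributes a
constant factor, which is 0 when \<open>\<phi> = 0\<close>.
\<close>

section \<open>Rotations and radial integrals in the plane\<close>

text \<open>The image measure \<open>N\<close> of Lebesgue measure is again translation invariant. Integrating
\<open>1\<^sub>A(x) 1\<^sub>B(y - x)\<close> against \<open>N\<close> in \<open>x\<close> and Lebesgue measure in \<open>y\<close>, in both orders, gives
\<open>N(A) \<lambda>(B) = \<lambda>(A) N(-B)\<close>. For \<open>B\<close> the unit ball, which \<open>f\<close> preserves, the two factors belonging
to \<open>B\<close> agree and cancel.\<close>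

lemma distr_lborel_orthogonal:
  fixes f g :: "'a::euclidean_space \<Rightarrow> 'a"
  assumes lin: "\<And>x y. f (x + y) = f x + f y"
    and nrm: "\<And>x. norm (f x) = norm x"
    and meas [measurable]: "f \<in> borel_measurable borel"
    and inv: "\<And>x. f (g x) = x"
  shows "distr lborel borel f = lborel"
proof -
  define N where "N = distr lborel borel f"
  have sets [simp, measurable_cong]: "sets N = sets borel" by (simp add: N_def)
  have space [simp]: "space N = UNIV" by (simp add: N_def)
  have ball: "emeasure N (cball 0 (real n)) = emeasure lborel (cball 0 (real n) :: 'a set)" for n
  proof -
    have "f -` cball 0 (real n) = cball 0 (real n)" by (auto simp: nrm)
    thus ?thesis by (simp add: N_def emeasure_distr)
  qed
  have sfN: "sigma_finite_measure N"
  proof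
    show "\<exists>A. countable A \<and> A \<subseteq> sets N \<and> \<Union> A = space N \<and> (\<forall>a\<in>A. emeasure N a \<noteq> \<infinity>)"
    proof (intro exI[of _ "range (\<lambda>n. cball (0::'a) (real n))"] conjI)
      show "\<Union> (range (\<lambda>n. cball (0::'a) (real n))) = space N"
        using real_arch_simple by auto
      show "\<forall>a\<in>range (\<lambda>n. cball (0::'a) (real n)). emeasure N a \<noteq> \<infinity>"
        by (auto simp: ball emeasure_cball)
    qed auto
  qed
  interpret N: sigma_finite_measure N by (rule sfN)
  interpret P: pair_sigma_finite N lborel
    by (intro pair_sigma_finite.intro sfN sigma_finite_lborel)
  have transL: "(\<integral>\<^sup>+ y. h (y + c) \<partial>lborel) = (\<integral>\<^sup>+ y. h y \<partial>lborel)"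
    if [measurable]: "h \<in> borel_measurable borel" for h :: "'a \<Rightarrow> ennreal" and c
    by (subst (2) lborel_distr_plus[of c, symmetric])
       (simp add: nn_integral_distr add.commute)
  have transN: "(\<integral>\<^sup>+ y. h (y + c) \<partial>N) = (\<integral>\<^sup>+ y. h y \<partial>N)"
    if [measurable]: "h \<in> borel_measurable borel" for h :: "'a \<Rightarrow> ennreal" and c
  proof -
    have "(\<integral>\<^sup>+ y. h (y + c) \<partial>N) = (\<integral>\<^sup>+ y. h (f (y + g c)) \<partial>lborel)"
      by (simp add: N_def nn_integral_distr lin inv)
    also have "\<dots> = (\<integral>\<^sup>+ y. h (f y) \<partial>lborel)" by (rule transL) simp
    also have "\<dots> = (\<integral>\<^sup>+ y. h y \<partial>N)" by (simp add: N_def nn_integral_distr)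
    finally show ?thesis .
  qed
  define B where "B = cball (0::'a) 1"
  have [measurable]: "B \<in> sets borel" by (simp add: B_def)
  have Bneg: "indicator B (- x) = (indicator B x :: ennreal)" for x by (simp add: B_def indicator_def)
  have Bm: "emeasure N B = emeasure lborel B"
    using ball[of 1] by (simp add: B_def)
  have Bfin: "emeasure lborel B \<noteq> \<infinity>" "emeasure lborel B \<noteq> 0"
    using unit_ball_vol_pos[of "real DIM('a)"] by (auto simp: B_def emeasure_cball simp del: unit_ball_vol_pos)
  have "N = lborel"
  proof (rule measure_eqI)
    fix A assume A: "A \<in> sets N"
    hence [measurable]: "A \<in> sets borel" by simp
    have "emeasure N A * emeasure lborel B = (\<integral>\<^sup>+ x. indicator A x * (\<integral>\<^sup>+ y. indicator B y \<partial>lborel) \<partial>N)"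
      by (simp add: nn_integral_multc)
    also have "\<dots> = (\<integral>\<^sup>+ x. (\<integral>\<^sup>+ y. indicator A x * indicator B (y + (- x)) \<partial>lborel) \<partial>N)"
      by (subst nn_integral_cmult; (subst transL)?) simp_all
    also have "\<dots> = (\<integral>\<^sup>+ y. (\<integral>\<^sup>+ x. indicator A x * indicator B (y + (- x)) \<partial>N) \<partial>lborel)"
      by (rule P.Fubini'[symmetric]) simp
    also have "\<dots> = (\<integral>\<^sup>+ y. (\<integral>\<^sup>+ x. indicator A (x + y) * indicator B x \<partial>N) \<partial>lborel)"
    proof (rule nn_integral_cong)
      fix y :: 'a
      have "(\<integral>\<^sup>+ x. indicator A x * indicator B (y + (- x)) \<partial>N) =
            (\<integral>\<^sup>+ x. indicator A (x + y) * indicator B (y + (- (x + y))) \<partial>N)"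
        by (rule transN[symmetric]) simp
      also have "\<dots> = (\<integral>\<^sup>+ x. indicator A (x + y) * indicator B x \<partial>N)"
        by (simp add: Bneg)
      finally show "(\<integral>\<^sup>+ x. indicator A x * indicator B (y + (- x)) \<partial>N) = \<dots>" .
    qed
    also have "\<dots> = (\<integral>\<^sup>+ x. (\<integral>\<^sup>+ y. indicator A (x + y) * indicator B x \<partial>lborel) \<partial>N)"
      by (rule P.Fubini') simp
    also have "\<dots> = (\<integral>\<^sup>+ x. indicator B x * emeasure lborel A \<partial>N)"
    proof (rule nn_integral_cong)
      fix x :: 'a
      have "(\<integral>\<^sup>+ y. indicator A (x + y) * indicator B x \<partial>lborel) =
          (\<integral>\<^sup>+ y. indicator A (y + x) \<partial>lborel) * indicator B x"
        by (simp add: nn_integral_multc add.commute)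
      also have "(\<integral>\<^sup>+ y. indicator A (y + x) \<partial>lborel) = emeasure lborel A"
        by (subst transL) simp_all
      finally show "(\<integral>\<^sup>+ y. indicator A (x + y) * indicator B x \<partial>lborel) = indicator B x * emeasure lborel A"
        by (simp add: mult.commute)
    qed
    also have "\<dots> = emeasure lborel A * emeasure lborel B"
      by (simp add: nn_integral_multc Bm mult.commute)
    finally show "emeasure N A = emeasure lborel A"
      using Bfin ennreal_mult_cancel_left[of "emeasure lborel B" "emeasure N A" "emeasure lborel A"]
      by (simp add: mult.commute)
  qed simp
  thus ?thesis by (simp add: N_def)
qed

lemma distr_lborel_rotation:
  fixes u :: complex
  assumes "cmod u = 1"
  shows "distr lborel borel (\<lambda>z. u * z) = lborel"
  by (rule distr_lborel_orthogonal[where g = "\<lambda>z. z / u"])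
     (use assms in \<open>auto simp: algebra_simps norm_mult\<close>)

lemma has_integral_indicator_UNIV:
  fixes f :: "real \<Rightarrow> real"
  assumes "(f has_integral I) S"
  shows "((\<lambda>t. indicator S t * f t) has_integral I) UNIV"
proof -
  have "(\<lambda>t. indicator S t * f t) = (\<lambda>t. if t \<in> S then f t else 0)" by auto
  thus ?thesis using assms by (simp only: has_integral_restrict_UNIV)
qed

text \<open>The disc \<open>a |z|\<^sup>m \<le> t\<close> has area \<open>\<pi> (t/a)\<^bsup>2/m\<^esup>\<close>; the density is the derivative of this area. Pushing
forward along \<open>a |z|\<^sup>m\<close> rather than \<open>|z|\<close> turns radial integrals into Gamma integrals without a
further substitution.\<close>

lemma distr_lborel_radial:
  fixes a m :: real
  assumes a: "a > 0" and m: "m > 0"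
  shows "distr lborel borel (\<lambda>z::complex. a * cmod z powr m) =
    density lborel (\<lambda>t. ennreal (indicator {0..} t * (2 * pi / (m * a powr (2 / m)) * t powr (2 / m - 1))))"
    (is "?M = ?N")
proof (rule measure_eqI_generator_eq[where \<Omega> = UNIV and E = "range atMost" and A = "\<lambda>n. {..real n}"])
  have Mr: "emeasure ?M {..r} = (if r < 0 then 0 else ennreal (pi * (r / a) powr (2 / m)))" for r
  proof (cases "r < 0")
    case True
    hence "(\<lambda>z::complex. a * cmod z powr m) -` {..r} = {}"
      using a by (auto simp: not_le dest: order.strict_trans1[of "a * cmod _ powr m" r 0])
        (smt (verit) mult_nonneg_nonneg powr_ge_zero)
    thus ?thesis using True by (simp add: emeasure_distr)
  next
    case False
    have "(a * cmod z powr m \<le> r) = (cmod z \<le> (r / a) powr (1 / m))" for z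
    proof
      assume "a * cmod z powr m \<le> r"
      hence "cmod z powr m \<le> r / a" using a by (simp add: field_simps)
      hence "(cmod z powr m) powr (1 / m) \<le> (r / a) powr (1 / m)"
        using m by (intro powr_mono2) auto
      thus "cmod z \<le> (r / a) powr (1 / m)" using m by (simp add: powr_powr)
    next
      assume "cmod z \<le> (r / a) powr (1 / m)"
      hence "cmod z powr m \<le> ((r / a) powr (1 / m)) powr m"
        using m by (intro powr_mono2) auto
      hence "cmod z powr m \<le> r / a" using m a False by (simp add: powr_powr)
      thus "a * cmod z powr m \<le> r" using a by (simp add: field_simps)
    qed
    hence "(\<lambda>z::complex. a * cmod z powr m) -` {..r} = cball 0 ((r / a) powr (1 / m))"
      by auto
    moreover have "((r / a) powr (1 / m))\<^sup>2 = (r / a) powr (2 / m)"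
      by (simp add: power2_eq_square powr_add[symmetric])
    ultimately show ?thesis using False
      by (simp add: emeasure_distr emeasure_cball eval_unit_ball_vol)
  qed
  have Nint: "emeasure ?N {..r} = (\<integral>\<^sup>+ t. ennreal (indicator {0..} t *
      (2 * pi / (m * a powr (2 / m)) * t powr (2 / m - 1))) * indicator {..r} t \<partial>lborel)" for r
    by (rule emeasure_density) auto
  have Nr: "emeasure ?N {..r} = (if r < 0 then 0 else ennreal (pi * (r / a) powr (2 / m)))" for r
  proof (cases "r < 0")
    case True
    have "emeasure ?N {..r} = (\<integral>\<^sup>+ (t::real). 0 \<partial>lborel)"
      unfolding Nint using True by (intro nn_integral_cong) (auto simp: indicator_def)
    thus ?thesis using True by simp
  next
    case False
    let ?C = "2 * pi / (m * a powr (2 / m))"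
    have "((\<lambda>t. t powr (2 / m - 1)) has_integral (r powr (2 / m - 1 + 1) / (2 / m - 1 + 1))) {0..r}"
      using m False by (intro has_integral_powr_from_0) auto
    hence "((\<lambda>t. ?C * t powr (2 / m - 1)) has_integral (?C * (r powr (2 / m) / (2 / m)))) {0..r}"
      by (intro has_integral_mult_right) simp
    hence 1: "((\<lambda>t. indicator {0..r} t * (?C * t powr (2 / m - 1))) has_integral (?C * (r powr (2 / m) / (2 / m)))) UNIV"
      by (rule has_integral_indicator_UNIV)
    have "emeasure ?N {..r} = (\<integral>\<^sup>+ t. ennreal (indicator {0..r} t * (?C * t powr (2 / m - 1))) \<partial>lborel)"
      unfolding Nint by (intro nn_integral_cong) (auto simp: indicator_def)
    also have "\<dots> = ennreal (?C * (r powr (2 / m) / (2 / m)))"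
      using 1 m a by (intro nn_integral_has_integral_lborel) auto
    also have "?C * (r powr (2 / m) / (2 / m)) = pi * (r / a) powr (2 / m)"
      using m a False by (simp add: powr_divide field_simps)
    finally show ?thesis using False by simp
  qed
  show "emeasure ?M X = emeasure ?N X" if "X \<in> range atMost" for X
    using that Mr Nr by auto
  show "emeasure ?M {..real n} \<noteq> \<infinity>" for n by (simp add: Mr)
  show "Int_stable (range (atMost :: real \<Rightarrow> _))"
    by (auto simp: Int_stable_def)
  show "(\<Union>n. {..real n}) = UNIV" using real_arch_simple by auto
qed (auto simp: borel_eq_atMost)

lemma nn_integral_cmod_powr_exp:
  fixes a m p :: real
  assumes a: "a > 0" and m: "m > 0" and p: "p > -2"
  shows "(\<integral>\<^sup>+ (z::complex). ennreal (cmod z powr p * exp (- a * cmod z powr m)) \<partial>lborel) =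
     ennreal (2 * pi / m * a powr (- (p + 2) / m) * Gamma ((p + 2) / m))"
proof -
  let ?C = "2 * pi / (m * a powr (2 / m))"
  let ?h = "\<lambda>t. (t / a) powr (p / m) * exp (- t)"
  have "(\<integral>\<^sup>+ (z::complex). ennreal (cmod z powr p * exp (- a * cmod z powr m)) \<partial>lborel)
      = (\<integral>\<^sup>+ (z::complex). ennreal (?h (a * cmod z powr m)) \<partial>lborel)"
    using a m by (simp add: powr_powr)
  also have "\<dots> = (\<integral>\<^sup>+ t. ennreal (?h t) \<partial>distr lborel borel (\<lambda>z::complex. a * cmod z powr m))"
    by (simp add: nn_integral_distr)
  also have "\<dots> = (\<integral>\<^sup>+ t. ennreal (indicator {0..} t * (?C * t powr (2 / m - 1))) * ennreal (?h t) \<partial>lborel)"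
    unfolding distr_lborel_radial[OF a m] by (simp add: nn_integral_density)
  also have "\<dots> = (\<integral>\<^sup>+ t. ennreal (indicator {0..} t * (?C * a powr (- p / m) * (t powr ((p + 2) / m - 1) / exp t))) \<partial>lborel)"
  proof (rule nn_integral_cong)
    fix t :: real
    have "indicator {0..} t * (?C * t powr (2 / m - 1)) * ?h t =
        indicator {0..} t * (?C * a powr (- p / m) * (t powr ((p + 2) / m - 1) / exp t))"
    proof (cases "t > 0")
      case True
      have "t powr (2 / m - 1) * t powr (p / m) = t powr ((p + 2) / m - 1)"
        using True by (simp add: powr_add[symmetric] add_divide_distrib algebra_simps)
      moreover have "(t / a) powr (p / m) = t powr (p / m) * a powr (- p / m)"
        using True a by (simp add: powr_divide powr_minus_divide)
      ultimately show ?thesis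
        by (simp add: exp_minus divide_inverse mult_ac)
    qed (use m in \<open>auto simp: indicator_def\<close>)
    thus "ennreal (indicator {0..} t * (?C * t powr (2 / m - 1))) * ennreal (?h t) =
       ennreal (indicator {0..} t * (?C * a powr (- p / m) * (t powr ((p + 2) / m - 1) / exp t)))"
      using m a by (subst ennreal_mult'[symmetric]) auto
  qed
  also have "\<dots> = ennreal (?C * a powr (- p / m) * Gamma ((p + 2) / m))"
  proof (rule nn_integral_has_integral_lborel)
    have "((\<lambda>t. ?C * a powr (- p / m) * (t powr ((p + 2) / m - 1) / exp t)) has_integral
        ?C * a powr (- p / m) * Gamma ((p + 2) / m)) {0..}"
      using m p by (intro has_integral_mult_right Gamma_integral_real) auto
    thus "((\<lambda>t. indicator {0..} t * (?C * a powr (- p / m) * (t powr ((p + 2) / m - 1) / exp t))) has_integral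
        ?C * a powr (- p / m) * Gamma ((p + 2) / m)) UNIV"
      by (rule has_integral_indicator_UNIV)
  qed (use m a in auto)
  also have "?C * a powr (- p / m) = 2 * pi / m * a powr (- (p + 2) / m)"
    using a by (simp add: powr_diff powr_minus add_divide_distrib diff_divide_distrib field_simps)
  finally show ?thesis .
qed

section \<open>Power sums with Gamma function denominators\<close>

lemma Digamma_increment_le:
  fixes b s :: real
  assumes "b > 0" "s \<ge> b"
  shows "Digamma (s + real n) \<le> Digamma s + real n / b"
proof (induction n)
  case (Suc n)
  have "Digamma (s + real n + 1) = Digamma (s + real n) + 1 / (s + real n)"
    by (rule Digamma_plus1) (use assms in auto)
  also have "1 / (s + real n) \<le> 1 / b"
    using assms by (intro divide_left_mono) auto
  finally show ?case using Suc by (simp add: add_divide_distrib add_ac)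
qed auto

text \<open>\<open>Digamma\<close> is the increasing derivative of \<open>ln_Gamma\<close>, so each increment lies between the ones given
by the slopes at the two ends.\<close>

lemma ln_Gamma_increment:
  fixes s x :: real
  assumes "s > 0" "x \<ge> 0"
  shows "ln_Gamma s + x * Digamma s \<le> ln_Gamma (s + x)"
    and "ln_Gamma (s + x) \<le> ln_Gamma s + x * Digamma (s + x)"
proof -
  have "ln_Gamma s + x * Digamma s \<le> ln_Gamma (s + x) \<and>
        ln_Gamma (s + x) \<le> ln_Gamma s + x * Digamma (s + x)"
  proof (cases "x = 0")
    case False
    hence "s < s + x" using assms by simp
    from MVT2[OF this, of ln_Gamma Digamma] assms
    obtain z where z: "s < z" "z < s + x" "ln_Gamma (s + x) - ln_Gamma s = x * Digamma z"
      by (force intro!: has_field_derivative_ln_Gamma_real)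
    moreover have "Digamma s \<le> Digamma z" "Digamma z \<le> Digamma (s + x)"
      using z assms by (auto intro!: Digamma_real_mono)
    hence "x * Digamma s \<le> x * Digamma z" "x * Digamma z \<le> x * Digamma (s + x)"
      using assms by (auto intro!: mult_left_mono)
    ultimately show ?thesis by linarith
  qed auto
  thus "ln_Gamma s + x * Digamma s \<le> ln_Gamma (s + x)"
    and "ln_Gamma (s + x) \<le> ln_Gamma s + x * Digamma (s + x)" by auto
qed

text \<open>The density of the Gamma distribution with parameter \<open>s\<close>, multiplied by \<open>exp t\<close>. The reciprocal
Gamma function gives it the value 0 at \<open>s = 0\<close>, so that a progression may start there.\<close>

definition gamma_weight :: "real \<Rightarrow> real \<Rightarrow> real" where
  "gamma_weight t s = t powr (s - 1) * rGamma s"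

lemma gamma_weight_nonneg [simp]: "s \<ge> 0 \<Longrightarrow> gamma_weight t s \<ge> 0"
  by (cases "s = 0") (auto simp: gamma_weight_def rGamma_inverse_Gamma less_imp_le)

lemma gamma_weight_eq_exp:
  assumes "t > 0" "s > 0"
  shows "gamma_weight t s = exp ((s - 1) * ln t - ln_Gamma s)"
  using assms
  by (simp add: gamma_weight_def rGamma_inverse_Gamma Gamma_real_pos_exp powr_def exp_diff divide_inverse)

text \<open>Put \<open>u = ln t - Digamma r\<close>. Moving from \<open>r\<close> to \<open>r + x\<close> multiplies the weight by at most \<open>exp (x u)\<close>,
and moving from \<open>r\<close> to \<open>r + b\<close> multiplies it by at least \<open>exp (b u)\<close> up to a constant, because
\<open>Digamma\<close> grows by a bounded amount on \<open>[r, r + b]\<close> when \<open>r \<ge> b\<close>. Since \<open>exp (x u)\<close> is at most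
\<open>1 + exp (b u)\<close>, the weight inside the interval is controlled by its values at the ends.\<close>

lemma gamma_weight_le_far:
  fixes b :: real
  assumes b: "b > 0"
  obtains C where "C > 0"
    "\<And>t r s. t > 0 \<Longrightarrow> r \<ge> b \<Longrightarrow> r \<le> s \<Longrightarrow> s \<le> r + b \<Longrightarrow>
       gamma_weight t s \<le> C * (gamma_weight t r + gamma_weight t (r + b))"
proof
  define N where "N = nat \<lceil>b\<rceil>"
  have N: "b \<le> real N" unfolding N_def by linarith
  show "exp (real N) > 0" by simp
  fix t r s :: real
  assume t: "t > 0" and rs: "r \<ge> b" "r \<le> s" "s \<le> r + b"
  define x where "x = s - r"
  have x: "0 \<le> x" "x \<le> b" "s = r + x" using rs by (auto simp: x_def)
  have r: "r > 0" using rs b by simp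
  define u where "u = ln t - Digamma r"
  have dig: "Digamma (r + b) \<le> Digamma r + real N / b"
    using Digamma_real_mono[of "r+b" "r + real N"] Digamma_increment_le[OF b rs(1), of N] N r b by simp
  have s1: "gamma_weight t s \<le> gamma_weight t r * exp (x * u)"
    using t r x ln_Gamma_increment(1)[OF r x(1)]
    by (simp add: gamma_weight_eq_exp exp_add[symmetric] u_def algebra_simps)
  have s2: "gamma_weight t r * exp (b * u) \<le> exp (real N) * gamma_weight t (r + b)"
  proof -
    have "b * Digamma (r + b) \<le> b * Digamma r + real N"
      using mult_left_mono[OF dig, of b] b by (simp add: algebra_simps)
    hence "ln_Gamma (r + b) \<le> ln_Gamma r + b * Digamma r + real N"
      using ln_Gamma_increment(2)[OF r, of b] b by simp
    thus ?thesis using t r b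
      by (simp add: gamma_weight_eq_exp exp_add[symmetric] u_def algebra_simps)
  qed
  have "exp (x * u) \<le> 1 + exp (b * u)"
  proof (cases "u \<ge> 0")
    case True
    hence "x * u \<le> b * u" using x by (intro mult_right_mono)
    hence "exp (x * u) \<le> exp (b * u)" by simp
    thus ?thesis by (smt (verit))
  next
    case False
    hence "x * u \<le> 0" using x by (simp add: mult_nonneg_nonpos)
    hence "exp (x * u) \<le> 1" by simp
    thus ?thesis by (smt (verit) exp_gt_zero)
  qed
  hence "gamma_weight t r * exp (x * u) \<le> gamma_weight t r * (1 + exp (b * u))"
    using r by (intro mult_left_mono) auto
  also have "\<dots> \<le> exp (real N) * gamma_weight t r + exp (real N) * gamma_weight t (r + b)"
  proof -
    have "1 * gamma_weight t r \<le> exp (real N) * gamma_weight t r"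
      using r by (intro mult_right_mono) auto
    thus ?thesis using s2 by (simp add: algebra_simps)
  qed
  finally show "gamma_weight t s \<le> exp (real N) * (gamma_weight t r + gamma_weight t (r + b))"
    using s1 by (simp add: algebra_simps)
qed

text \<open>The slope argument fails on \<open>[0, b]\<close> because \<open>Digamma\<close> is unbounded near 0, but the reciprocal Gamma
function is bounded there and \<open>t\<^bsup>s-1\<^esup>\<close> increases with \<open>s\<close> for \<open>t \<ge> 1\<close>.\<close>

lemma gamma_weight_le_near:
  fixes b :: real
  assumes b: "b > 0"
  obtains C where "C > 0"
    "\<And>t s. t \<ge> 1 \<Longrightarrow> 0 \<le> s \<Longrightarrow> s \<le> b \<Longrightarrow> gamma_weight t s \<le> C * gamma_weight t b"
proof -
  have "compact ((rGamma :: real \<Rightarrow> real) ` {0..b})"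
    by (intro compact_continuous_image continuous_on_rGamma) auto
  then obtain K where K: "\<And>s. 0 \<le> s \<Longrightarrow> s \<le> b \<Longrightarrow> \<bar>rGamma s\<bar> \<le> K"
    by (force simp: bounded_iff dest!: compact_imp_bounded)
  have G: "Gamma b > 0" using b by simp
  show thesis
  proof
    show "(\<bar>K\<bar> + 1) * Gamma b > 0" using G by simp
    fix t s :: real assume t: "t \<ge> 1" and s: "0 \<le> s" "s \<le> b"
    have "gamma_weight t s \<le> t powr (b - 1) * (\<bar>K\<bar> + 1)"
      unfolding gamma_weight_def
    proof (rule mult_mono)
      show "t powr (s - 1) \<le> t powr (b - 1)" using t s by (intro powr_mono) auto
      show "rGamma s \<le> \<bar>K\<bar> + 1" using K[OF s] by linarith
      show "0 \<le> rGamma s" using s by (cases "s = 0") (auto simp: rGamma_inverse_Gamma less_imp_le)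
    qed auto
    also have "\<dots> = (\<bar>K\<bar> + 1) * Gamma b * gamma_weight t b"
      using G by (simp add: gamma_weight_def rGamma_inverse_Gamma field_simps)
    finally show "gamma_weight t s \<le> (\<bar>K\<bar> + 1) * Gamma b * gamma_weight t b" .
  qed
qed

lemma gamma_weight_le_ends:
  fixes b :: real
  assumes b: "b > 0"
  obtains C where "C > 0"
    "\<And>t s j. t \<ge> 1 \<Longrightarrow> b * real j \<le> s \<Longrightarrow> s \<le> b * real (Suc j) \<Longrightarrow>
       gamma_weight t s \<le> C * (gamma_weight t (b * real j) + gamma_weight t (b * real (Suc j)))"
proof -
  obtain C1 where C1: "C1 > 0" "\<And>t r s. t > 0 \<Longrightarrow> r \<ge> b \<Longrightarrow> r \<le> s \<Longrightarrow> s \<le> r + b \<Longrightarrow>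
       gamma_weight t s \<le> C1 * (gamma_weight t r + gamma_weight t (r + b))"
    using gamma_weight_le_far[OF b] by blast
  obtain C2 where C2: "C2 > 0"
    "\<And>t s. t \<ge> 1 \<Longrightarrow> 0 \<le> s \<Longrightarrow> s \<le> b \<Longrightarrow> gamma_weight t s \<le> C2 * gamma_weight t b"
    using gamma_weight_le_near[OF b] by blast
  show thesis
  proof
    show "max C1 C2 > 0" using C1 by auto
    fix t s :: real and j :: nat
    assume t: "t \<ge> 1" and s: "b * real j \<le> s" "s \<le> b * real (Suc j)"
    let ?S = "gamma_weight t (b * real j) + gamma_weight t (b * real (Suc j))"
    have S: "?S \<ge> 0" using b by (intro add_nonneg_nonneg gamma_weight_nonneg) auto
    show "gamma_weight t s \<le> max C1 C2 * ?S"
    proof (cases "j = 0")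
      case True
      hence "gamma_weight t s \<le> C2 * ?S"
        using C2(2)[of t s] t s by (simp add: gamma_weight_def)
      also have "\<dots> \<le> max C1 C2 * ?S" using S by (intro mult_right_mono) auto
      finally show ?thesis .
    next
      case False
      hence "b * 1 \<le> b * real j" using b by (intro mult_left_mono) auto
      hence "gamma_weight t s \<le> C1 * ?S"
        using C1(2)[of t "b * real j" s] t s by (simp add: algebra_simps)
      also have "\<dots> \<le> max C1 C2 * ?S" using S by (intro mult_right_mono) auto
      finally show ?thesis .
    qed
  qed
qed

lemma ennreal_suminf_swap:
  fixes f :: "nat \<Rightarrow> nat \<Rightarrow> ennreal"
  shows "(\<Sum>i. \<Sum>j. f i j) = (\<Sum>j. \<Sum>i. f i j)"
proof -
  have "(\<Sum>i. \<Sum>j. f i j) = (\<Sum>i. \<integral>\<^sup>+ j. f i j \<partial>count_space UNIV)"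
    by (simp add: nn_integral_count_space_nat)
  also have "\<dots> = (\<integral>\<^sup>+ j. (\<Sum>i. f i j) \<partial>count_space UNIV)"
    by (rule nn_integral_suminf[symmetric]) auto
  also have "\<dots> = (\<Sum>j. \<Sum>i. f i j)" by (simp add: nn_integral_count_space_nat)
  finally show ?thesis .
qed

text \<open>Exchange the order of summation: each \<open>F j\<close> is counted as often as \<open>g\<close> takes the value \<open>j\<close>.\<close>

lemma suminf_comp_le_card_fibre:
  fixes F :: "nat \<Rightarrow> ennreal" and g :: "nat \<Rightarrow> nat"
  assumes fin: "\<And>j. finite {n. g n = j}" and card: "\<And>j. card {n. g n = j} \<le> D"
  shows "(\<Sum>n. F (g n)) \<le> of_nat D * (\<Sum>j. F j)"
proof -
  have "(\<Sum>n. F (g n)) = (\<Sum>n. \<Sum>j. if j = g n then F j else 0)"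
  proof (rule arg_cong[where f = suminf], rule ext)
    fix n
    show "F (g n) = (\<Sum>j. if j = g n then F j else 0)"
      by (subst suminf_finite[of "{g n}"]) auto
  qed
  also have "\<dots> = (\<Sum>j. \<Sum>n. if j = g n then F j else 0)"
    by (rule ennreal_suminf_swap)
  also have "\<dots> \<le> (\<Sum>j. of_nat D * F j)"
  proof (intro suminf_le summableI)
    fix j
    have "(\<Sum>n. if j = g n then F j else 0) = (\<Sum>n\<in>{n. g n = j}. if j = g n then F j else 0)"
      by (rule suminf_finite[OF fin]) auto
    also have "\<dots> = of_nat (card {n. g n = j}) * F j" by simp
    also have "\<dots> \<le> of_nat D * F j" using card by (intro mult_right_mono) auto
    finally show "(\<Sum>n. if j = g n then F j else 0) \<le> of_nat D * F j" .
  qed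
  also have "\<dots> = of_nat D * (\<Sum>j. F j)" by simp
  finally show ?thesis .
qed

text \<open>Each point of the progression with step \<open>c\<close> lies between two neighbours of the progression with
step \<open>b\<close>, whose weights dominate its own, and at most about \<open>b/c\<close> points share the same neighbours.
The statement is applied in both directions, with one of the steps equal to 1.\<close>

lemma gamma_weight_sums_comparable:
  fixes b c :: real
  assumes b: "b > 0" and c: "c > 0"
  obtains C where "C > 0"
    "\<And>t. t \<ge> 1 \<Longrightarrow> (\<Sum>n. ennreal (gamma_weight t (c * real (Suc n))))
        \<le> ennreal C * (\<Sum>n. ennreal (gamma_weight t (b * real (Suc n))))"
proof -
  obtain K where K: "K > 0"
    "\<And>t s j. t \<ge> 1 \<Longrightarrow> b * real j \<le> s \<Longrightarrow> s \<le> b * real (Suc j) \<Longrightarrow>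
       gamma_weight t s \<le> K * (gamma_weight t (b * real j) + gamma_weight t (b * real (Suc j)))"
    using gamma_weight_le_ends[OF b] by blast
  define g where "g n = nat \<lfloor>c * real (Suc n) / b\<rfloor>" for n
  define D where "D = Suc (nat \<lceil>b / c\<rceil>)"
  have g: "b * real (g n) \<le> c * real (Suc n)" "c * real (Suc n) < b * real (Suc (g n))" for n
  proof -
    have nn: "c * real (Suc n) / b \<ge> 0" using b c by simp
    have "real (g n) \<le> c * real (Suc n) / b"
      unfolding g_def using nn by linarith
    thus "b * real (g n) \<le> c * real (Suc n)" using b by (simp add: field_simps)
    have "c * real (Suc n) / b < real (Suc (g n))"
      unfolding g_def using nn by linarith
    thus "c * real (Suc n) < b * real (Suc (g n))" using b by (simp add: field_simps)
  qed
  have fib: "{n. g n = j} \<subseteq> {n0..<n0 + D}" if "n0 = (LEAST n. g n = j)" for j n0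
  proof
    fix n assume n: "n \<in> {n. g n = j}"
    hence le: "n0 \<le> n" and n0: "g n0 = j" unfolding that by (auto intro: Least_le LeastI)
    have "c * real n - c * real n0 < b"
      using g(1)[of n0] g(2)[of n] n n0 by (simp add: algebra_simps)
    hence "real n - real n0 < b / c" using c by (simp add: field_simps)
    hence "n < n0 + D" unfolding D_def by linarith
    thus "n \<in> {n0..<n0 + D}" using le by simp
  qed
  have fin: "finite {n. g n = j}" for j
    using fib[OF refl, of j] by (rule finite_subset) auto
  have card: "card {n. g n = j} \<le> D" for j
    using card_mono[OF _ fib[OF refl, of j]] by simp
  have D: "real D > 0" by (simp add: D_def)
  show thesis
  proof
    show "2 * (K * real D) > 0" using K D by simp
    fix t :: real assume t: "t \<ge> 1"
    define h where "h j = ennreal (gamma_weight t (b * real j))" for j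
    have h0: "h 0 = 0" by (simp add: h_def gamma_weight_def)
    have "(\<Sum>n. ennreal (gamma_weight t (c * real (Suc n)))) \<le> (\<Sum>n. ennreal K * (h (g n) + h (Suc (g n))))"
    proof (intro suminf_le summableI)
      fix n
      have "gamma_weight t (c * real (Suc n)) \<le>
          K * (gamma_weight t (b * real (g n)) + gamma_weight t (b * real (Suc (g n))))"
        using K(2)[OF t g(1) less_imp_le[OF g(2)]] .
      thus "ennreal (gamma_weight t (c * real (Suc n))) \<le> ennreal K * (h (g n) + h (Suc (g n)))"
        using K b by (simp add: h_def ennreal_mult'[symmetric] ennreal_plus[symmetric]
           ennreal_leI del: ennreal_plus of_nat_Suc)
    qed
    also have "\<dots> \<le> of_nat D * (\<Sum>j. ennreal K * (h j + h (Suc j)))"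
      by (rule suminf_comp_le_card_fibre[OF fin card])
    also have "(\<Sum>j. ennreal K * (h j + h (Suc j))) = ennreal K * ((\<Sum>j. h j) + (\<Sum>j. h (Suc j)))"
      by (simp add: suminf_add)
    also have "(\<Sum>j. h j) = (\<Sum>j. h (Suc j))"
      using suminf_offset[of h 1] h0 by simp
    also have "of_nat D * (ennreal K * ((\<Sum>j. h (Suc j)) + (\<Sum>j. h (Suc j)))) =
       ennreal (2 * (K * real D)) * (\<Sum>j. h (Suc j))"
      using K by (simp add: ennreal_mult ennreal_of_nat_eq_real_of_nat mult_2[symmetric] mult_ac)
    finally show "(\<Sum>n. ennreal (gamma_weight t (c * real (Suc n))))
        \<le> ennreal (2 * (K * real D)) * (\<Sum>n. ennreal (gamma_weight t (b * real (Suc n))))"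
      by (simp add: h_def)
  qed
qed

lemma suminf_gamma_weight_1:
  assumes "t > 0"
  shows "(\<Sum>n. ennreal (gamma_weight t (1 * real (Suc n)))) = ennreal (exp t)"
proof -
  have "gamma_weight t (1 * real (Suc n)) = t ^ n /\<^sub>R fact n" for n
    using assms Gamma_fact[of n, where 'a = real]
    by (simp add: gamma_weight_def rGamma_inverse_Gamma powr_realpow field_simps)
  moreover have "(\<lambda>n. t ^ n /\<^sub>R fact n) sums exp t"
    by (rule exp_converges)
  ultimately show ?thesis using assms
    by (subst suminf_ennreal_eq[of _ "exp t"]) (auto simp: scaleR_conv_of_real)
qed

lemma suminf_gamma_weight_exp:
  fixes b :: real
  assumes b: "b > 0"
  obtains C where "C > 0"
    "\<And>t. t \<ge> 1 \<Longrightarrow> (\<Sum>n. ennreal (gamma_weight t (b * real (Suc n)))) \<le> ennreal (C * exp t)"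
    "\<And>t. t \<ge> 1 \<Longrightarrow> ennreal (exp t) \<le> ennreal C * (\<Sum>n. ennreal (gamma_weight t (b * real (Suc n))))"
proof -
  obtain C1 where C1: "C1 > 0" "\<And>t. t \<ge> 1 \<Longrightarrow> (\<Sum>n. ennreal (gamma_weight t (b * real (Suc n))))
        \<le> ennreal C1 * (\<Sum>n. ennreal (gamma_weight t (1 * real (Suc n))))"
    by (rule gamma_weight_sums_comparable[OF zero_less_one b]) blast
  obtain C2 where C2: "C2 > 0" "\<And>t. t \<ge> 1 \<Longrightarrow> (\<Sum>n. ennreal (gamma_weight t (1 * real (Suc n))))
        \<le> ennreal C2 * (\<Sum>n. ennreal (gamma_weight t (b * real (Suc n))))"
    by (rule gamma_weight_sums_comparable[OF b zero_less_one]) blast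
  show thesis
  proof
    show "max C1 C2 > 0" using C1 by auto
    fix t :: real assume t: "t \<ge> 1"
    have S1: "(\<Sum>n. ennreal (gamma_weight t (1 * real (Suc n)))) = ennreal (exp t)"
      using t by (intro suminf_gamma_weight_1) simp
    have "(\<Sum>n. ennreal (gamma_weight t (b * real (Suc n)))) \<le> ennreal C1 * ennreal (exp t)"
      using C1(2)[OF t] unfolding S1 .
    also have "\<dots> = ennreal (C1 * exp t)"
      using C1(1) by (intro ennreal_mult[symmetric]) auto
    also have "\<dots> \<le> ennreal (max C1 C2 * exp t)"
      by (intro ennreal_leI mult_right_mono) auto
    finally show "(\<Sum>n. ennreal (gamma_weight t (b * real (Suc n)))) \<le> ennreal (max C1 C2 * exp t)" .
    have "ennreal (exp t) \<le> ennreal C2 * (\<Sum>n. ennreal (gamma_weight t (b * real (Suc n))))"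
      using C2(2)[OF t] unfolding S1 .
    also have "\<dots> \<le> ennreal (max C1 C2) * (\<Sum>n. ennreal (gamma_weight t (b * real (Suc n))))"
      by (intro mult_right_mono ennreal_leI) auto
    finally show "ennreal (exp t) \<le> ennreal (max C1 C2) * (\<Sum>n. ennreal (gamma_weight t (b * real (Suc n))))" .
  qed
qed

section \<open>Entire functions controlled by an exponential weight\<close>

lemma entire_affine_remainder:
  assumes "f holomorphic_on UNIV"
  obtains g where "g holomorphic_on UNIV" "\<And>z. f z = f 0 + deriv f 0 * z + z\<^sup>2 * g z"
proof -
  define q where "q = (\<lambda>z. if z = 0 then deriv f 0 else (f z - f 0) / (z - 0))"
  define g where "g = (\<lambda>z. if z = 0 then deriv q 0 else (q z - q 0) / (z - 0))"
  have q: "q holomorphic_on UNIV" unfolding q_def by (rule pole_lemma) (use assms in auto)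
  show thesis
  proof
    show "g holomorphic_on UNIV" unfolding g_def by (rule pole_lemma) (use q in auto)
    show "f z = f 0 + deriv f 0 * z + z\<^sup>2 * g z" for z
      by (auto simp: g_def q_def field_simps power2_eq_square)
  qed
qed

text \<open>The inequality \<open>u \<le> exp u\<close> at \<open>u = a x / p\<close>, raised to the power \<open>p\<close>.\<close>

lemma powr_le_exp:
  fixes p a x :: real
  assumes "p > 0" "a > 0" "x \<ge> 0"
  shows "x powr p \<le> (p / a) powr p * exp (a * x)"
proof -
  have "a * x / p \<le> exp (a * x / p)"
    using exp_ge_add_one_self[of "a * x / p"] by linarith
  hence "(a * x / p) powr p \<le> exp (a * x / p) powr p"
    using assms by (intro powr_mono2) auto
  also have "\<dots> = exp (a * x)" using assms by (simp add: powr_def)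
  finally have "(p / a) powr p * (a * x / p) powr p \<le> (p / a) powr p * exp (a * x)"
    by (intro mult_left_mono) auto
  also have "(p / a) powr p * (a * x / p) powr p = x powr p"
    using assms by (subst powr_mult[symmetric]) (auto simp: field_simps)
  finally show ?thesis .
qed

lemma power_add_le: 
  fixes x y :: real
  assumes "x \<ge> 0" "y \<ge> 0"
  shows "(x + y) ^ k \<le> 2 ^ k * (x ^ k + y ^ k)"
proof -
  have "(x + y) ^ k \<le> (2 * max x y) ^ k" using assms by (intro power_mono) auto
  also have "\<dots> = 2 ^ k * max x y ^ k" by (simp add: power_mult_distrib)
  also have "max x y ^ k \<le> x ^ k + y ^ k" using assms by (auto simp: max_def)
  finally show ?thesis by simp
qed

text \<open>Write \<open>\<phi> z = L z + z\<^sup>2 g z\<close> with \<open>L\<close> the first-order Taylor polynomial at 0. On the circle of radius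
\<open>r = k\<^bsup>1/m\<^esup>\<close> the hypothesis bounds \<open>|\<psi>| |\<phi>|\<^sup>k\<close> by \<open>C (exp b * B * r)\<^sup>k\<close>, and the same kind of bound holds for
\<open>|\<psi>| |L|\<^sup>k\<close>, hence for \<open>|\<psi>| |z\<^sup>2 g|\<^sup>k\<close>. Dividing by \<open>r\<^bsup>2k\<^esup>\<close> leaves \<open>|\<psi> g\<^sup>k| \<le> 2 C (D / r)\<^sup>k\<close> on the
circle, and by the maximum principle inside it. As \<open>k\<close> grows, \<open>D / r\<close> tends to 0, so \<open>\<psi> g = 0\<close>.
Applying the maximum principle to the product \<open>\<psi> g\<^sup>k\<close> avoids any lower bound for \<open>\<psi>\<close>.\<close>

lemma entire_affine_of_exp_bound:
  fixes a b C m :: real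
  assumes psi: "\<psi> holomorphic_on UNIV" and phi: "\<phi> holomorphic_on UNIV"
    and a: "a > 0" and m: "m > 0"
    and bound: "\<And>z. cmod (\<psi> z) * exp (a * cmod (\<phi> z) powr m) \<le> C * exp (b * cmod z powr m)"
    and nz: "\<psi> z1 \<noteq> 0"
  shows "\<phi> z = \<phi> 0 + deriv \<phi> 0 * z"
proof -
  obtain g where g: "g holomorphic_on UNIV" "\<And>z. \<phi> z = \<phi> 0 + deriv \<phi> 0 * z + z\<^sup>2 * g z"
    using entire_affine_remainder[OF phi] by blast
  define A where "A = cmod (\<phi> 0) + cmod (deriv \<phi> 0)"
  define B where "B = (1 / (m * a)) powr (1 / m)"
  define D where "D = 2 * exp b * (A + B)"
  have A: "A \<ge> 0" and B: "B > 0" using m a by (auto simp: A_def B_def)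
  have C: "C \<ge> 0"
  proof -
    have "0 \<le> C * exp (b * cmod z1 powr m)" by (rule order_trans[OF _ bound]) simp
    thus ?thesis by (simp add: zero_le_mult_iff)
  qed
  have D: "D > 0" using A B by (simp add: D_def)
  have circle: "cmod (\<psi> z * g z ^ k) \<le> 2 * C * (D / r) ^ k"
    if k: "k > 0" and r: "r = real k powr (1 / m)" and z: "cmod z = r" for k :: nat and r z
  proof -
    have rm: "r powr m = real k" using m k by (simp add: r powr_powr)
    have r1: "r \<ge> 1" using k m unfolding r by (intro ge_one_powr_ge_zero) auto
    \<comment> \<open>the exponent \<open>k / m\<close> turns \<open>|\<phi> z|\<^sup>m\<close> into \<open>|\<phi> z|\<^sup>k\<close>, and the constant into \<open>(B r)\<^sup>k\<close>, since \<open>k = r\<^sup>m\<close>\<close>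
    have "(cmod (\<phi> z) powr m) powr (real k / m) \<le> (real k / m / a) powr (real k / m) * exp (a * cmod (\<phi> z) powr m)"
      using k m a by (intro powr_le_exp) auto
    moreover have "(cmod (\<phi> z) powr m) powr (real k / m) = cmod (\<phi> z) ^ k"
      using m k by (cases "cmod (\<phi> z) = 0") (auto simp: powr_powr powr_realpow)
    moreover have "(real k / m / a) powr (real k / m) = (B * r) ^ k"
    proof -
      have "B * r = (real k / m / a) powr (1 / m)"
        using m a by (simp add: B_def r powr_mult[symmetric] field_simps)
      moreover have "(B * r) ^ k = (B * r) powr real k"
        using B r1 by (intro powr_realpow[symmetric] mult_pos_pos) auto
      ultimately show ?thesis by (simp add: powr_powr)
    qed
    ultimately have p1: "cmod (\<phi> z) ^ k \<le> (B * r) ^ k * exp (a * cmod (\<phi> z) powr m)" by simp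
    have "cmod (\<psi> z) * cmod (\<phi> z) ^ k \<le> cmod (\<psi> z) * ((B * r) ^ k * exp (a * cmod (\<phi> z) powr m))"
      by (intro mult_left_mono p1) auto
    also have "\<dots> = (B * r) ^ k * (cmod (\<psi> z) * exp (a * cmod (\<phi> z) powr m))" by simp
    also have "\<dots> \<le> (B * r) ^ k * (C * exp (b * real k))"
      using bound[of z] B r1 by (intro mult_left_mono) (auto simp: z rm)
    finally have e1: "cmod (\<psi> z) * cmod (\<phi> z) ^ k \<le> C * (exp b * B * r) ^ k"
      by (simp add: power_mult_distrib exp_of_nat_mult[symmetric] mult_ac)
    have "cmod (\<psi> z) \<le> cmod (\<psi> z) * exp (a * cmod (\<phi> z) powr m)"
      using a by (intro mult_le_cancel_left1[THEN iffD2]) auto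
    also have "\<dots> \<le> C * exp (b * real k)" using bound[of z] by (simp add: z rm)
    finally have "cmod (\<psi> z) \<le> C * exp (b * real k)" .
    moreover have "cmod (\<phi> 0 + deriv \<phi> 0 * z) \<le> A * r"
    proof -
      have "cmod (\<phi> 0 + deriv \<phi> 0 * z) \<le> cmod (\<phi> 0) * 1 + cmod (deriv \<phi> 0) * r"
        using norm_triangle_ineq[of "\<phi> 0" "deriv \<phi> 0 * z"] by (simp add: norm_mult z)
      also have "\<dots> \<le> cmod (\<phi> 0) * r + cmod (deriv \<phi> 0) * r"
        using r1 by (intro add_mono mult_left_mono) auto
      also have "\<dots> = A * r" by (simp add: A_def algebra_simps)
      finally show ?thesis .
    qed
    ultimately have "cmod (\<psi> z) * cmod (\<phi> 0 + deriv \<phi> 0 * z) ^ k \<le> C * exp (b * real k) * (A * r) ^ k"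
      using C by (intro mult_mono power_mono) auto
    hence e2: "cmod (\<psi> z) * cmod (\<phi> 0 + deriv \<phi> 0 * z) ^ k \<le> C * (exp b * A * r) ^ k"
      by (simp add: power_mult_distrib exp_of_nat_mult[symmetric] mult_ac)
    have "cmod (z\<^sup>2 * g z) \<le> cmod (\<phi> z) + cmod (\<phi> 0 + deriv \<phi> 0 * z)"
      using norm_triangle_ineq4[of "\<phi> z" "\<phi> 0 + deriv \<phi> 0 * z"] g(2)[of z] by (simp add: algebra_simps)
    hence "cmod (z\<^sup>2 * g z) ^ k \<le> (cmod (\<phi> z) + cmod (\<phi> 0 + deriv \<phi> 0 * z)) ^ k"
      by (intro power_mono) auto
    also have "\<dots> \<le> 2 ^ k * (cmod (\<phi> z) ^ k + cmod (\<phi> 0 + deriv \<phi> 0 * z) ^ k)"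
      by (intro power_add_le) auto
    finally have "cmod (\<psi> z) * cmod (z\<^sup>2 * g z) ^ k \<le>
        cmod (\<psi> z) * (2 ^ k * (cmod (\<phi> z) ^ k + cmod (\<phi> 0 + deriv \<phi> 0 * z) ^ k))"
      by (intro mult_left_mono) auto
    also have "\<dots> \<le> 2 ^ k * (C * (exp b * B * r) ^ k + C * (exp b * A * r) ^ k)"
      using mult_left_mono[OF add_mono[OF e1 e2], of "2 ^ k"] by (simp add: distrib_left mult.left_commute)
    also have "\<dots> \<le> 2 ^ k * (C * (exp b * (A + B) * r) ^ k + C * (exp b * (A + B) * r) ^ k)"
      using A B C r1 by (intro mult_left_mono add_mono power_mono mult_right_mono) auto
    also have "\<dots> = 2 * C * (D * r) ^ k"
    proof -
      have "D * r = 2 * (exp b * (A + B) * r)" by (simp add: D_def)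
      hence "(D * r) ^ k = 2 ^ k * (exp b * (A + B) * r) ^ k" by (simp only: power_mult_distrib)
      thus ?thesis by simp
    qed
    finally have "cmod (\<psi> z) * cmod (z\<^sup>2 * g z) ^ k \<le> 2 * C * (D * r) ^ k" .
    moreover have "cmod (\<psi> z) * cmod (z\<^sup>2 * g z) ^ k = cmod (\<psi> z * g z ^ k) * (r\<^sup>2) ^ k"
      by (simp add: norm_mult norm_power power_mult_distrib z)
    ultimately have "cmod (\<psi> z * g z ^ k) \<le> 2 * C * (D * r) ^ k / (r\<^sup>2) ^ k"
      using r1 by (simp add: field_simps)
    also have "\<dots> = 2 * C * (D / r) ^ k"
      using r1 by (simp add: power_mult_distrib power_divide power2_eq_square)
    finally show ?thesis .
  qed
  have prod0: "\<psi> w * g w = 0" for w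
  proof (rule ccontr)
    assume nz: "\<psi> w * g w \<noteq> 0"
    have lim: "filterlim (\<lambda>k. real k powr (1 / m)) at_top sequentially"
      using m by (intro filterlim_compose[OF real_powr_at_top filterlim_real_sequentially]) auto
    have "eventually (\<lambda>k. cmod (\<psi> w) \<le> 2 * C * (1 / 2) ^ k) sequentially"
      using filterlim_at_top[THEN iffD1, OF lim, rule_format, of "2 * D / cmod (g w)"]
        filterlim_at_top[THEN iffD1, OF lim, rule_format, of "cmod w"] eventually_gt_at_top[of 0]
    proof eventually_elim
      case (elim k)
      define r where "r = real k powr (1 / m)"
      have r: "r > 0" using elim by (simp add: r_def)
      have "cmod (\<psi> w * g w ^ k) \<le> 2 * C * (D / r) ^ k"
      proof (rule maximum_modulus_frontier[of "\<lambda>z. \<psi> z * g z ^ k" "cball 0 r"])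
        show "(\<lambda>z. \<psi> z * g z ^ k) holomorphic_on interior (cball 0 r)"
          by (intro holomorphic_intros holomorphic_on_subset[OF psi] holomorphic_on_subset[OF g(1)]) auto
        have "(\<lambda>z. \<psi> z * g z ^ k) holomorphic_on UNIV"
          by (intro holomorphic_intros psi g(1))
        thus "continuous_on (closure (cball 0 r)) (\<lambda>z. \<psi> z * g z ^ k)"
          by (intro holomorphic_on_imp_continuous_on) (rule holomorphic_on_subset, auto)
        show "cmod (\<psi> z * g z ^ k) \<le> 2 * C * (D / r) ^ k" if "z \<in> frontier (cball 0 r)" for z
          using that elim r by (intro circle) (auto simp: r_def)
      qed (use elim in \<open>auto simp: r_def\<close>)
      also have "\<dots> \<le> 2 * C * (cmod (g w) / 2) ^ k"
      proof (intro mult_left_mono power_mono)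
        have "2 * D / cmod (g w) \<le> r" using elim by (simp add: r_def)
        thus "D / r \<le> cmod (g w) / 2" using r nz by (simp add: field_simps)
      qed (use C D r in auto)
      finally have "cmod (\<psi> w) * cmod (g w) ^ k \<le> 2 * C * (1 / 2) ^ k * cmod (g w) ^ k"
        by (simp add: norm_mult norm_power power_divide)
      thus ?case using nz by simp
    qed
    moreover have "(\<lambda>k. 2 * C * (1 / 2) ^ k) \<longlonglongrightarrow> 2 * C * 0"
      by (intro tendsto_mult tendsto_const LIMSEQ_power_zero) simp
    ultimately have "cmod (\<psi> w) \<le> 2 * C * 0"
      by (intro tendsto_le[OF sequentially_bot _ tendsto_const]) auto
    thus False using nz by simp
  qed
  have cont: "continuous_on UNIV \<psi>" using psi by (rule holomorphic_on_imp_continuous_on)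
  have "open (\<psi> -` (- {0}))" by (rule open_vimage[OF _ cont]) auto
  hence "g z = (\<lambda>_. 0) z"
    by (rule analytic_continuation_open[where s' = UNIV])
       (use nz g(1) prod0 in \<open>auto simp: vimage_def\<close>)
  thus ?thesis using g(2)[of z] by simp
qed

section \<open>Power series in the weighted Fock space\<close>

lemma cnj_measurable [measurable]: "cnj \<in> borel_measurable borel"
  by (intro borel_measurable_continuous_onI continuous_intros)

lemma indicator_cball_measurable [measurable]:
  "indicat_real (cball (0::complex) R) \<in> borel_measurable borel"
  by (rule borel_measurable_indicator) simp

lemma ennreal_sum_le_suminf:
  fixes g :: "nat \<Rightarrow> real"
  assumes "\<And>n. g n \<ge> 0"
  shows "ennreal (\<Sum>n<N. g n) \<le> (\<Sum>n. ennreal (g n))"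
proof -
  have "ennreal (\<Sum>n<N. g n) = (\<Sum>n<N. ennreal (g n))"
    using assms by (simp add: sum_ennreal)
  thus ?thesis by (simp add: sum_le_suminf)
qed

lemma summable_norm_entire_series:
  fixes a :: "nat \<Rightarrow> complex"
  assumes "\<And>z. summable (\<lambda>n. a n * z ^ n)" and "R \<ge> 0"
  shows "summable (\<lambda>n. cmod (a n) * R ^ n)"
  using powser_insidea[OF assms(1)[of "of_real (R + 1)"], of "of_real R"] assms(2)
  by (simp add: norm_mult norm_power)

lemma entire_power_series:
  assumes "f holomorphic_on UNIV"
  obtains a :: "nat \<Rightarrow> complex" where "\<And>z. (\<lambda>n. a n * z ^ n) sums f z"
proof
  fix z
  show "(\<lambda>n. (deriv ^^ n) f 0 / fact n * z ^ n) sums f z"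
    using holomorphic_power_series[of f 0 "cmod z + 1" z] holomorphic_on_subset[OF assms]
    by simp
qed

lemma holomorphic_measurable:
  assumes "f holomorphic_on UNIV"
  shows "f \<in> borel_measurable borel"
  using assms by (intro borel_measurable_continuous_onI holomorphic_on_imp_continuous_on)

locale fock_parameters =
  fixes \<alpha> m :: real
  assumes m: "m > 0" and \<alpha>: "\<alpha> > 0"
begin

abbreviation \<mu> :: "complex measure" where "\<mu> \<equiv> fock_measure \<alpha> m"

definition weight :: "complex \<Rightarrow> real" where
  "weight z = m * \<alpha> powr (2 / m) / (2 * pi * Gamma (2 / m)) * exp (- \<alpha> * cmod z powr m)"

definition sq_norm :: "(complex \<Rightarrow> complex) \<Rightarrow> ennreal" where
  "sq_norm f = (\<integral>\<^sup>+ z. ennreal ((cmod (f z))\<^sup>2) \<partial>\<mu>)"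

text \<open>The squared norm of the monomial of degree \<open>n\<close>; see \<open>nn_integral_monomial\<close>.\<close>

definition monomial_sq_norm :: "nat \<Rightarrow> real" where
  "monomial_sq_norm n = \<alpha> powr (- (2 * real n / m)) * Gamma (2 / m * real (Suc n)) / Gamma (2 / m)"

text \<open>The reproducing kernel at a point of the diagonal depends only on the modulus \<open>x\<close> of the point.
It is taken with values in the extended reals so that sums and integrals can be exchanged before
finiteness is known.\<close>

definition kernel :: "real \<Rightarrow> ennreal" where
  "kernel x = (\<Sum>n. ennreal (x ^ (2 * n) / monomial_sq_norm n))"

lemma Gamma_2_over_m_pos: "Gamma (2 / m) > 0" using m by simp

lemma weight_pos: "weight z > 0"
  using m \<alpha> Gamma_2_over_m_pos by (simp add: weight_def)

lemma weight_measurable [measurable]: "weight \<in> borel_measurable borel"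
  unfolding weight_def by measurable

lemma fock_measure_eq: "\<mu> = density lborel (\<lambda>z. ennreal (weight z))"
  by (simp add: fock_measure_def weight_def)

lemma sets_fock [simp, measurable_cong]: "sets \<mu> = sets borel"
  and space_fock [simp]: "space \<mu> = UNIV"
  by (simp_all add: fock_measure_eq)

lemma measurable_fock [simp]:
  "borel_measurable \<mu> = (borel_measurable borel :: (complex \<Rightarrow> 'b::topological_space) set)"
  by (rule measurable_cong_sets) simp_all

lemma nn_integral_fock:
  assumes [measurable]: "f \<in> borel_measurable borel"
  shows "(\<integral>\<^sup>+ z. f z \<partial>\<mu>) = (\<integral>\<^sup>+ z. ennreal (weight z) * f z \<partial>lborel)"
  unfolding fock_measure_eq by (rule nn_integral_density) auto

lemma monomial_sq_norm_pos: "monomial_sq_norm n > 0"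
  using m \<alpha> by (simp add: monomial_sq_norm_def)

lemma monomial_sq_norm_0: "monomial_sq_norm 0 = 1"
  using Gamma_2_over_m_pos \<alpha> by (simp add: monomial_sq_norm_def)

lemma nn_integral_monomial:
  "(\<integral>\<^sup>+ z. ennreal (cmod z ^ (2 * n)) \<partial>\<mu>) = ennreal (monomial_sq_norm n)"
proof -
  let ?K = "m * \<alpha> powr (2 / m) / (2 * pi * Gamma (2 / m))"
  have K: "?K > 0" using m \<alpha> Gamma_2_over_m_pos by simp
  have "(\<integral>\<^sup>+ z. ennreal (cmod z ^ (2 * n)) \<partial>\<mu>) =
      (\<integral>\<^sup>+ z. ennreal (weight z) * ennreal (cmod z ^ (2 * n)) \<partial>lborel)"
    by (rule nn_integral_fock) simp
  also have "\<dots> = (\<integral>\<^sup>+ (z::complex). ennreal ?K * ennreal (cmod z powr (2 * real n) * exp (- \<alpha> * cmod z powr m)) \<partial>lborel)"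
  proof (rule nn_integral_cong_AE, rule eventually_mono[OF AE_lborel_singleton[of 0]])
    fix z :: complex assume z: "z \<noteq> 0"
    have "cmod z powr (2 * real n) = cmod z ^ (2 * n)"
      using z powr_realpow[of "cmod z" "2 * n"] by simp
    thus "ennreal (weight z) * ennreal (cmod z ^ (2 * n)) =
        ennreal ?K * ennreal (cmod z powr (2 * real n) * exp (- \<alpha> * cmod z powr m))"
      using K weight_pos[of z]
      by (simp add: ennreal_mult'[symmetric] weight_def mult_ac)
  qed
  also have "\<dots> = ennreal ?K * ennreal (2 * pi / m * \<alpha> powr (- (2 * real n + 2) / m) * Gamma ((2 * real n + 2) / m))"
    by (subst nn_integral_cmult, simp, subst nn_integral_cmod_powr_exp[OF \<alpha> m]) auto
  also have "\<dots> = ennreal (?K * (2 * pi / m * \<alpha> powr (- (2 * real n + 2) / m) * Gamma ((2 * real n + 2) / m)))"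
    using K by (intro ennreal_mult'[symmetric]) simp
  also have "?K * (2 * pi / m * \<alpha> powr (- (2 * real n + 2) / m) * Gamma ((2 * real n + 2) / m)) = monomial_sq_norm n"
  proof -
    have "\<alpha> powr (2 / m) * \<alpha> powr (- (2 * real n + 2) / m) = \<alpha> powr (- (2 * real n / m))"
      using \<alpha> by (simp add: powr_add[symmetric] add_divide_distrib diff_divide_distrib)
    moreover have "(2 * real n + 2) / m = 2 / m * real (Suc n)"
      by (simp add: add_divide_distrib algebra_simps)
    ultimately have "monomial_sq_norm n = \<alpha> powr (2 / m) * \<alpha> powr (- (2 * real n + 2) / m) *
        Gamma ((2 * real n + 2) / m) / Gamma (2 / m)"
      by (simp only: monomial_sq_norm_def)
    thus ?thesis using m by simp
  qed
  finally show ?thesis .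
qed

lemma emeasure_fock_UNIV: "emeasure \<mu> UNIV = 1"
  using nn_integral_monomial[of 0] by (simp add: monomial_sq_norm_0)

lemma finite_measure_fock: "finite_measure \<mu>"
  by (rule finite_measureI) (simp add: emeasure_fock_UNIV)

lemma integral_fock_rotation:
  fixes F :: "complex \<Rightarrow> complex"
  assumes [measurable]: "F \<in> borel_measurable borel" and u: "cmod u = 1"
  shows "(LINT z|\<mu>. F (u * z)) = (LINT z|\<mu>. F z)"
proof -
  have w: "weight (u * z) = weight z" for z by (simp add: weight_def norm_mult u)
  have "(LINT z|\<mu>. F z) = (LINT z|lborel. weight z *\<^sub>R F z)"
    unfolding fock_measure_eq using weight_pos by (subst integral_density) (auto simp: less_imp_le)
  also have "\<dots> = (LINT z|distr lborel borel (\<lambda>z. u * z). weight z *\<^sub>R F z)"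
    by (simp only: distr_lborel_rotation[OF u])
  also have "\<dots> = (LINT z|lborel. weight z *\<^sub>R F (u * z))"
    by (subst integral_distr) (auto simp: w)
  also have "\<dots> = (LINT z|\<mu>. F (u * z))"
    unfolding fock_measure_eq using weight_pos by (subst integral_density) (auto simp: less_imp_le)
  finally show ?thesis ..
qed

text \<open>Rotating by the angle \<open>\<pi> / (j - k)\<close> changes the sign of the integrand.\<close>

lemma integral_monomials_orthogonal:
  fixes g :: "complex \<Rightarrow> real"
  assumes [measurable]: "g \<in> borel_measurable borel"
    and rad: "\<And>u z. cmod u = 1 \<Longrightarrow> g (u * z) = g z" and jk: "j \<noteq> k"
  shows "(LINT z|\<mu>. g z *\<^sub>R (z ^ j * cnj (z ^ k))) = 0"
proof -
  define d where "d = real j - real k"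
  have d: "d \<noteq> 0" using jk by (simp add: d_def)
  define u where "u = cis (pi / d)"
  have u: "cmod u = 1" by (simp add: u_def)
  have "u ^ j * cnj (u ^ k) = cis (real j * (pi / d)) * cis (- (real k * (pi / d)))"
    by (simp add: u_def Complex.DeMoivre cis_cnj)
  also have "\<dots> = cis (d * (pi / d))"
    by (simp add: cis_mult d_def algebra_simps diff_divide_distrib)
  also have "\<dots> = -1" using d by simp
  finally have uu: "u ^ j * cnj (u ^ k) = -1" .
  have "(LINT z|\<mu>. g z *\<^sub>R (z ^ j * cnj (z ^ k))) =
     (LINT z|\<mu>. g (u * z) *\<^sub>R ((u * z) ^ j * cnj ((u * z) ^ k)))"
    by (rule integral_fock_rotation[OF _ u, symmetric]) simp
  also have "\<dots> = (LINT z|\<mu>. - (g z *\<^sub>R (z ^ j * cnj (z ^ k))))"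
  proof (rule Bochner_Integration.integral_cong[OF refl])
    fix z
    have "(u * z) ^ j * cnj ((u * z) ^ k) = (u ^ j * cnj (u ^ k)) * (z ^ j * cnj (z ^ k))"
      by (simp add: power_mult_distrib)
    thus "g (u * z) *\<^sub>R ((u * z) ^ j * cnj ((u * z) ^ k)) = - (g z *\<^sub>R (z ^ j * cnj (z ^ k)))"
      by (simp only: uu rad[OF u]) simp
  qed
  also have "\<dots> = - (LINT z|\<mu>. g z *\<^sub>R (z ^ j * cnj (z ^ k)))" by simp
  finally show ?thesis by simp
qed

lemma parseval_disc_polynomial:
  fixes a :: "nat \<Rightarrow> complex" and R :: real
  shows "(LINT z|\<mu>. indicator (cball 0 R) z * (cmod (\<Sum>n<N. a n * z ^ n))\<^sup>2) =
    (LINT z|\<mu>. indicator (cball 0 R) z * (\<Sum>n<N. (cmod (a n))\<^sup>2 * cmod z ^ (2 * n)))"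
proof -
  interpret finite_measure \<mu> by (rule finite_measure_fock)
  let ?I = "indicator (cball 0 R) :: complex \<Rightarrow> real"
  let ?m = "\<lambda>j k z. ?I z *\<^sub>R (z ^ j * cnj (z ^ k))"
  have bnd: "cmod (?m j k z) \<le> \<bar>R\<bar> ^ j * \<bar>R\<bar> ^ k" for j k z
    by (auto simp: indicator_def norm_mult norm_power intro!: mult_mono power_mono)
  have int: "integrable \<mu> (?m j k)" for j k
  proof (rule integrable_const_bound[where B = "\<bar>R\<bar> ^ j * \<bar>R\<bar> ^ k"])
    show "AE z in \<mu>. cmod (?m j k z) \<le> \<bar>R\<bar> ^ j * \<bar>R\<bar> ^ k" by (intro AE_I2 bnd)
    have "?I \<in> borel_measurable borel" by (rule indicator_cball_measurable)
    moreover have "(\<lambda>z. z ^ j * cnj (z ^ k)) \<in> borel_measurable borel"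
      by (intro borel_measurable_continuous_onI continuous_intros)
    ultimately show "?m j k \<in> borel_measurable \<mu>"
      unfolding measurable_fock by (rule borel_measurable_scaleR)
  qed
  have radial: "?I (u * z) = ?I z" if "cmod u = 1" for u z
    using that by (simp add: indicator_def norm_mult)
  have "complex_of_real (LINT z|\<mu>. ?I z * (cmod (\<Sum>n<N. a n * z ^ n))\<^sup>2) =
      (LINT z|\<mu>. (\<Sum>j<N. \<Sum>k<N. (a j * cnj (a k)) * ?m j k z))"
  proof (subst integral_complex_of_real[symmetric], rule Bochner_Integration.integral_cong[OF refl])
    fix z
    have "complex_of_real ((cmod (\<Sum>n<N. a n * z ^ n))\<^sup>2) = (\<Sum>n<N. a n * z ^ n) * cnj (\<Sum>n<N. a n * z ^ n)"
      by (rule complex_norm_square)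
    also have "\<dots> = (\<Sum>j<N. \<Sum>k<N. (a j * cnj (a k)) * (z ^ j * cnj (z ^ k)))"
      by (simp add: cnj_sum sum_product mult_ac)
    finally show "complex_of_real (?I z * (cmod (\<Sum>n<N. a n * z ^ n))\<^sup>2) =
        (\<Sum>j<N. \<Sum>k<N. (a j * cnj (a k)) * ?m j k z)"
      by (simp add: sum_distrib_left scaleR_conv_of_real mult_ac)
  qed
  also have "\<dots> = (\<Sum>j<N. \<Sum>k<N. (a j * cnj (a k)) * (LINT z|\<mu>. ?m j k z))"
    by (simp only: Bochner_Integration.integral_sum Bochner_Integration.integrable_sum
        integrable_mult_right int integral_mult_right_zero)
  also have "\<dots> = (\<Sum>j<N. \<Sum>k<N. if k = j then (a j * cnj (a j)) * (LINT z|\<mu>. ?m j j z) else 0)"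
    by (intro sum.cong refl) (use integral_monomials_orthogonal[OF _ radial] in auto)
  also have "\<dots> = (\<Sum>j<N. (a j * cnj (a j)) * (LINT z|\<mu>. ?m j j z))"
    by simp
  also have "\<dots> = (LINT z|\<mu>. (\<Sum>j<N. (a j * cnj (a j)) * ?m j j z))"
    by (simp only: Bochner_Integration.integral_sum Bochner_Integration.integrable_sum
        integrable_mult_right int integral_mult_right_zero)
  also have "\<dots> = complex_of_real (LINT z|\<mu>. ?I z * (\<Sum>n<N. (cmod (a n))\<^sup>2 * cmod z ^ (2 * n)))"
  proof (subst integral_complex_of_real[symmetric], rule Bochner_Integration.integral_cong[OF refl])
    fix z
    have "(a j * cnj (a j)) * ?m j j z = complex_of_real (?I z * ((cmod (a j))\<^sup>2 * cmod z ^ (2 * j)))" for j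
      by (simp add: complex_norm_square[symmetric] scaleR_conv_of_real norm_power power_mult[symmetric] mult_ac
          del: complex_cnj_power)
    thus "(\<Sum>j<N. (a j * cnj (a j)) * ?m j j z) =
        complex_of_real (?I z * (\<Sum>n<N. (cmod (a n))\<^sup>2 * cmod z ^ (2 * n)))"
      by (simp only: sum_distrib_left of_real_sum)
  qed
  finally show ?thesis by (simp only: of_real_eq_iff)
qed

text \<open>On a disc the partial sums converge boundedly, so Parseval's identity passes from polynomials to
\<open>f\<close>; then the disc exhausts the plane by monotone convergence. The identity holds in the
extended sense, so it also decides whether an entire function belongs to the space.\<close>

lemma sq_norm_power_series:
  fixes a :: "nat \<Rightarrow> complex"
  assumes f: "\<And>z. (\<lambda>n. a n * z ^ n) sums f z"
  shows "sq_norm f = (\<Sum>n. ennreal ((cmod (a n))\<^sup>2 * monomial_sq_norm n))"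
proof -
  interpret finite_measure \<mu> by (rule finite_measure_fock)
  define P where "P N z = (\<Sum>n<N. a n * z ^ n)" for N z
  define q where "q n z = (cmod (a n))\<^sup>2 * cmod z ^ (2 * n)" for n z
  define Q where "Q z = (\<Sum>n. q n z)" for z
  have Plim: "(\<lambda>N. P N z) \<longlonglongrightarrow> f z" for z
    using f[of z] by (simp add: sums_def P_def)
  have Pmeas [measurable]: "P N \<in> borel_measurable borel" for N
    unfolding P_def by measurable
  have [measurable]: "f \<in> borel_measurable borel"
    by (rule borel_measurable_LIMSEQ_metric[OF Pmeas Plim])
  have [measurable]: "q n \<in> borel_measurable borel" for n
    unfolding q_def by measurable
  have [measurable]: "Q \<in> borel_measurable borel"
    unfolding Q_def by measurable
  have q0: "q n z \<ge> 0" for n z by (simp add: q_def)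
  have summ: "summable (\<lambda>n. cmod (a n) * R ^ n)" if "R \<ge> 0" for R
    by (rule summable_norm_entire_series[OF sums_summable[OF f] that])
  have bound: "cmod (P N z) \<le> (\<Sum>n. cmod (a n) * R ^ n)"
      "(\<Sum>n<N. q n z) \<le> (\<Sum>n. cmod (a n) * R ^ n)\<^sup>2" if z: "cmod z \<le> R" for N z R
  proof -
    have R: "R \<ge> 0" using z norm_ge_zero[of z] by linarith
    let ?A = "\<Sum>n. cmod (a n) * R ^ n"
    have part: "(\<Sum>n\<in>S. cmod (a n) * cmod z ^ n) \<le> ?A" if "finite S" for S
    proof -
      have "(\<Sum>n\<in>S. cmod (a n) * cmod z ^ n) \<le> (\<Sum>n\<in>S. cmod (a n) * R ^ n)"
        by (intro sum_mono mult_left_mono power_mono z) auto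
      also have "\<dots> \<le> ?A" by (rule sum_le_suminf[OF summ[OF R] that]) (use R in auto)
      finally show ?thesis .
    qed
    have A0: "?A \<ge> 0" using part[of "{}"] by simp
    have "cmod (P N z) \<le> (\<Sum>n<N. cmod (a n) * cmod z ^ n)"
      unfolding P_def by (rule order_trans[OF norm_sum]) (simp add: norm_mult norm_power)
    also have "\<dots> \<le> ?A" by (rule part) simp
    finally show "cmod (P N z) \<le> ?A" .
    have "(\<Sum>n<N. q n z) \<le> (\<Sum>n<N. ?A * (cmod (a n) * cmod z ^ n))"
    proof (rule sum_mono)
      fix n
      have "q n z = (cmod (a n) * cmod z ^ n) * (cmod (a n) * cmod z ^ n)"
        unfolding q_def mult_2 power_add power2_eq_square by (simp only: mult_ac)
      also have "\<dots> \<le> ?A * (cmod (a n) * cmod z ^ n)"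
        using part[of "{n}"] by (intro mult_right_mono) auto
      finally show "q n z \<le> ?A * (cmod (a n) * cmod z ^ n)" .
    qed
    also have "\<dots> = ?A * (\<Sum>n<N. cmod (a n) * cmod z ^ n)" by (simp add: sum_distrib_left)
    also have "\<dots> \<le> ?A * ?A" by (intro mult_left_mono part A0) auto
    finally show "(\<Sum>n<N. q n z) \<le> ?A\<^sup>2" by (simp add: power2_eq_square)
  qed
  have qsum: "summable (\<lambda>n. q n z)" for z
    by (rule summableI_nonneg_bounded[OF q0 bound(2)]) (rule order_refl)
  have Qlim: "(\<lambda>N. \<Sum>n<N. q n z) \<longlonglongrightarrow> Q z" for z
    using summable_sums[OF qsum[of z]] by (simp add: sums_def Q_def)
  have Q0: "Q z \<ge> 0" for z unfolding Q_def by (intro suminf_nonneg qsum q0)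
  have disc: "(\<integral>\<^sup>+ z. ennreal (indicator (cball 0 R) z * (cmod (f z))\<^sup>2) \<partial>\<mu>) =
              (\<integral>\<^sup>+ z. ennreal (indicator (cball 0 R) z * Q z) \<partial>\<mu>)" for R :: real
  proof -
    let ?I = "indicator (cball 0 R) :: complex \<Rightarrow> real"
    let ?A = "\<Sum>n. cmod (a n) * R ^ n"
    have fl: "AE z in \<mu>. (\<lambda>N. ?I z * (cmod (P N z))\<^sup>2) \<longlonglongrightarrow> ?I z * (cmod (f z))\<^sup>2"
      by (intro AE_I2 tendsto_intros Plim)
    have fb: "AE z in \<mu>. norm (?I z * (cmod (P N z))\<^sup>2) \<le> ?A\<^sup>2" for N
      by (intro AE_I2) (auto simp: indicator_def intro!: power_mono bound)
    have ql: "AE z in \<mu>. (\<lambda>N. ?I z * (\<Sum>n<N. q n z)) \<longlonglongrightarrow> ?I z * Q z"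
      by (intro AE_I2 tendsto_intros Qlim)
    have qb: "AE z in \<mu>. norm (?I z * (\<Sum>n<N. q n z)) \<le> ?A\<^sup>2" for N
      by (intro AE_I2) (auto simp: indicator_def sum_nonneg q0 intro!: bound)
    have "(\<lambda>N. LINT z|\<mu>. ?I z * (cmod (P N z))\<^sup>2) \<longlonglongrightarrow> (LINT z|\<mu>. ?I z * (cmod (f z))\<^sup>2)"
      by (rule integral_dominated_convergence[where w = "\<lambda>_. ?A\<^sup>2", OF _ _ _ fl fb]; (simp; measurable)?)
    moreover have "(\<lambda>N. LINT z|\<mu>. ?I z * (\<Sum>n<N. q n z)) \<longlonglongrightarrow> (LINT z|\<mu>. ?I z * Q z)"
      by (rule integral_dominated_convergence[where w = "\<lambda>_. ?A\<^sup>2", OF _ _ _ ql qb]) auto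
    moreover have "(LINT z|\<mu>. ?I z * (cmod (P N z))\<^sup>2) = (LINT z|\<mu>. ?I z * (\<Sum>n<N. q n z))" for N
      unfolding P_def q_def by (rule parseval_disc_polynomial)
    ultimately have eq: "(LINT z|\<mu>. ?I z * (cmod (f z))\<^sup>2) = (LINT z|\<mu>. ?I z * Q z)"
      using LIMSEQ_unique by auto
    have "integrable \<mu> (\<lambda>z. ?I z * (cmod (f z))\<^sup>2)"
      by (rule integrable_dominated_convergence[where w = "\<lambda>_. ?A\<^sup>2", OF _ _ _ fl fb]) auto
    moreover have "integrable \<mu> (\<lambda>z. ?I z * Q z)"
      by (rule integrable_dominated_convergence[where w = "\<lambda>_. ?A\<^sup>2", OF _ _ _ ql qb]) auto
    ultimately show ?thesis
      using eq Q0 by (simp add: nn_integral_eq_integral)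
  qed
  have exhaust: "(\<lambda>k. \<integral>\<^sup>+ z. ennreal (indicator (cball 0 (real k)) z * h z) \<partial>\<mu>) \<longlonglongrightarrow> (\<integral>\<^sup>+ z. ennreal (h z) \<partial>\<mu>)"
    if [measurable]: "h \<in> borel_measurable borel" and h0: "\<And>z. h z \<ge> 0" for h :: "complex \<Rightarrow> real"
  proof (rule nn_integral_LIMSEQ)
    show "incseq (\<lambda>k z. ennreal (indicator (cball 0 (real k)) z * h z))"
      by (rule incseq_SucI) (auto simp: le_fun_def indicator_def h0 intro!: ennreal_leI)
    fix z :: complex
    obtain k0 where k0: "cmod z \<le> real k0" using real_arch_simple by blast
    show "(\<lambda>k. ennreal (indicator (cball 0 (real k)) z * h z)) \<longlonglongrightarrow> ennreal (h z)"
      by (rule tendsto_eventually, rule eventually_mono[OF eventually_ge_at_top[of k0]])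
         (use k0 in \<open>auto simp: indicator_def\<close>)
  qed measurable
  have "sq_norm f = (\<integral>\<^sup>+ z. ennreal (Q z) \<partial>\<mu>)"
    unfolding sq_norm_def
    using exhaust[of "\<lambda>z. (cmod (f z))\<^sup>2"] exhaust[of Q] Q0 by (auto simp: disc intro: LIMSEQ_unique)
  also have "\<dots> = (\<integral>\<^sup>+ z. (\<Sum>n. ennreal (q n z)) \<partial>\<mu>)"
    by (simp add: Q_def suminf_ennreal2[OF q0 qsum])
  also have "\<dots> = (\<Sum>n. \<integral>\<^sup>+ z. ennreal (q n z) \<partial>\<mu>)"
    by (rule nn_integral_suminf) simp
  also have "\<dots> = (\<Sum>n. ennreal ((cmod (a n))\<^sup>2 * monomial_sq_norm n))"
    unfolding q_def
    by (simp add: ennreal_mult' nn_integral_cmult nn_integral_monomial)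
  finally show ?thesis .
qed

lemma mem_fock_space_iff: "f \<in> fock_space \<alpha> m \<longleftrightarrow> f holomorphic_on UNIV \<and> sq_norm f < \<infinity>"
proof -
  have "integrable \<mu> (\<lambda>z. (cmod (f z))\<^sup>2) \<longleftrightarrow> sq_norm f < \<infinity>" if "f holomorphic_on UNIV"
    using holomorphic_measurable[OF that] by (simp add: integrable_iff_bounded sq_norm_def)
  thus ?thesis by (auto simp: fock_space_def)
qed

lemma sq_norm_eq_fock_norm:
  assumes "f \<in> fock_space \<alpha> m"
  shows "sq_norm f = ennreal ((fock_norm \<alpha> m f)\<^sup>2)"
  using assms by (simp add: fock_space_def sq_norm_def fock_norm_def nn_integral_eq_integral)

text \<open>The Cauchy-Schwarz inequality for the products of \<open>a\<^sub>n sqrt c\<^sub>n\<close> and \<open>w\<^sup>n / sqrt c\<^sub>n\<close>.\<close>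

lemma cmod_sq_le_kernel:
  assumes "f holomorphic_on UNIV"
  shows "ennreal ((cmod (f w))\<^sup>2) \<le> sq_norm f * kernel (cmod w)"
proof -
  obtain a where a: "\<And>z. (\<lambda>n. a n * z ^ n) sums f z"
    using entire_power_series[OF assms] by blast
  let ?c = monomial_sq_norm
  have "(\<lambda>N. ennreal ((cmod (\<Sum>n<N. a n * w ^ n))\<^sup>2)) \<longlonglongrightarrow> ennreal ((cmod (f w))\<^sup>2)"
    using a[of w] by (intro tendsto_intros) (simp add: sums_def)
  moreover have "ennreal ((cmod (\<Sum>n<N. a n * w ^ n))\<^sup>2) \<le> sq_norm f * kernel (cmod w)" for N
  proof -
    let ?S = "\<Sum>n<N. (cmod (a n))\<^sup>2 * ?c n" and ?T = "\<Sum>n<N. cmod w ^ (2 * n) / ?c n"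
    have "cmod (\<Sum>n<N. a n * w ^ n) \<le> (\<Sum>n<N. (cmod (a n) * sqrt (?c n)) * (cmod w ^ n / sqrt (?c n)))"
      by (rule order_trans[OF norm_sum])
         (use monomial_sq_norm_pos in \<open>auto intro!: sum_mono simp: norm_mult norm_power less_imp_neq[THEN not_sym]\<close>)
    hence "(cmod (\<Sum>n<N. a n * w ^ n))\<^sup>2 \<le> (\<Sum>n<N. (cmod (a n) * sqrt (?c n)) * (cmod w ^ n / sqrt (?c n)))\<^sup>2"
      by (intro power_mono) auto
    also have "\<dots> \<le> (\<Sum>n<N. (cmod (a n) * sqrt (?c n))\<^sup>2) * (\<Sum>n<N. (cmod w ^ n / sqrt (?c n))\<^sup>2)"
      by (rule Cauchy_Schwarz_ineq_sum)
    also have "\<dots> = ?S * ?T"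
      using monomial_sq_norm_pos
      by (simp add: power_mult_distrib power_divide less_imp_le power_mult[symmetric] mult.commute)
    finally have "ennreal ((cmod (\<Sum>n<N. a n * w ^ n))\<^sup>2) \<le> ennreal ?S * ennreal ?T"
      using monomial_sq_norm_pos
      by (subst ennreal_mult[symmetric]) (auto intro!: ennreal_leI sum_nonneg simp: less_imp_le)
    also have "ennreal ?S \<le> sq_norm f"
      unfolding sq_norm_power_series[OF a]
      by (rule ennreal_sum_le_suminf) (simp add: monomial_sq_norm_pos less_imp_le)
    also have "ennreal ?T \<le> kernel (cmod w)"
      unfolding kernel_def
      by (rule ennreal_sum_le_suminf) (simp add: monomial_sq_norm_pos less_imp_le)
    finally show ?thesis by (simp add: mult_mono)
  qed
  ultimately show ?thesis by (meson LIMSEQ_le_const2)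
qed

section \<open>Growth of the reproducing kernel\<close>

lemma kernel_mono: "0 \<le> x \<Longrightarrow> x \<le> y \<Longrightarrow> kernel x \<le> kernel y"
  unfolding kernel_def using monomial_sq_norm_pos
  by (intro suminf_le summableI ennreal_leI divide_right_mono power_mono) (auto simp: less_imp_le)

lemma kernel_ge_1: "kernel x \<ge> 1"
proof -
  have "(\<Sum>n\<in>{0}. ennreal (x ^ (2 * n) / monomial_sq_norm n)) \<le> kernel x"
    unfolding kernel_def by (intro sum_le_suminf) auto
  thus ?thesis by (simp add: monomial_sq_norm_0)
qed

text \<open>The order of growth of the kernel. At \<open>x = 0\<close> its value is 0, by the convention for \<open>powr\<close>.\<close>

definition growth :: "real \<Rightarrow> real" where
  "growth x = x powr (m - 2) * exp (\<alpha> * x powr m)"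

lemma growth_nonneg [simp]: "growth x \<ge> 0"
  by (simp add: growth_def)

lemma kernel_eq_suminf_gamma_weight:
  assumes x: "x > 0"
  shows "kernel x = ennreal (Gamma (2 / m) * \<alpha> powr (1 - 2 / m) * x powr (m - 2)) *
    (\<Sum>n. ennreal (gamma_weight (\<alpha> * x powr m) (2 / m * real (Suc n))))"
proof -
  let ?K = "Gamma (2 / m) * \<alpha> powr (1 - 2 / m) * x powr (m - 2)"
  have K: "?K \<ge> 0" using Gamma_2_over_m_pos by simp
  have summand: "x ^ (2 * n) / monomial_sq_norm n = ?K * gamma_weight (\<alpha> * x powr m) (2 / m * real (Suc n))" for n
  proof -
    have G: "Gamma (2 / m * real (Suc n)) > 0" using m by simp
    have "(\<alpha> * x powr m) powr (2 / m * real (Suc n) - 1) =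
        \<alpha> powr (2 / m * real (Suc n) - 1) * x powr (2 * real (Suc n) - m)"
    proof -
      have "m * (2 / m * real (Suc n) - 1) = 2 * real (Suc n) - m" using m by (simp add: field_simps)
      thus ?thesis using \<alpha> x by (simp add: powr_mult powr_powr del: of_nat_Suc)
    qed
    hence "\<alpha> powr (1 - 2 / m) * x powr (m - 2) * (\<alpha> * x powr m) powr (2 / m * real (Suc n) - 1) =
       (\<alpha> powr (1 - 2 / m) * \<alpha> powr (2 / m * real (Suc n) - 1)) * (x powr (m - 2) * x powr (2 * real (Suc n) - m))"
      by simp
    also have "\<alpha> powr (1 - 2 / m) * \<alpha> powr (2 / m * real (Suc n) - 1) = \<alpha> powr (2 * real n / m)"
      unfolding powr_add[symmetric] by (rule arg_cong) (simp add: algebra_simps add_divide_distrib)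
    also have "x powr (m - 2) * x powr (2 * real (Suc n) - m) = x ^ (2 * n)"
      using x powr_realpow[of x "2 * n"] by (simp add: powr_add[symmetric])
    finally have e: "\<alpha> powr (1 - 2 / m) * x powr (m - 2) * (\<alpha> * x powr m) powr (2 / m * real (Suc n) - 1) =
       \<alpha> powr (2 * real n / m) * x ^ (2 * n)" .
    have "?K * gamma_weight (\<alpha> * x powr m) (2 / m * real (Suc n)) =
        Gamma (2 / m) / Gamma (2 / m * real (Suc n)) *
        (\<alpha> powr (1 - 2 / m) * x powr (m - 2) * (\<alpha> * x powr m) powr (2 / m * real (Suc n) - 1))"
      unfolding gamma_weight_def rGamma_inverse_Gamma divide_inverse by (simp only: mult_ac)
    also have "\<dots> = x ^ (2 * n) / monomial_sq_norm n"
      unfolding e using G Gamma_2_over_m_pos \<alpha> by (simp add: monomial_sq_norm_def powr_minus field_simps)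
    finally show ?thesis ..
  qed
  have "ennreal (x ^ (2 * n) / monomial_sq_norm n) =
      ennreal ?K * ennreal (gamma_weight (\<alpha> * x powr m) (2 / m * real (Suc n)))" for n
    unfolding summand by (rule ennreal_mult'[OF K])
  thus ?thesis unfolding kernel_def by simp
qed

text \<open>Insert \<open>t = \<alpha> x\<^sup>m\<close> into the two-sided comparison of the Gamma sums with \<open>exp t\<close>.\<close>

lemma kernel_comparable_growth:
  obtains C where "C > 0"
    "\<And>x. x \<ge> 0 \<Longrightarrow> \<alpha> * x powr m \<ge> 1 \<Longrightarrow> kernel x \<le> ennreal (C * growth x)"
    "\<And>x. x \<ge> 0 \<Longrightarrow> \<alpha> * x powr m \<ge> 1 \<Longrightarrow> ennreal (growth x) \<le> ennreal C * kernel x"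
proof -
  have "2 / m > 0" using m by simp
  then obtain C where C: "C > 0"
    "\<And>t. t \<ge> 1 \<Longrightarrow> (\<Sum>n. ennreal (gamma_weight t (2 / m * real (Suc n)))) \<le> ennreal (C * exp t)"
    "\<And>t. t \<ge> 1 \<Longrightarrow> ennreal (exp t) \<le> ennreal C * (\<Sum>n. ennreal (gamma_weight t (2 / m * real (Suc n))))"
    using suminf_gamma_weight_exp by blast
  define L where "L = Gamma (2 / m) * \<alpha> powr (1 - 2 / m)"
  have L: "L > 0" using Gamma_2_over_m_pos \<alpha> by (simp add: L_def)
  show thesis
  proof (rule that[of "max (L * C) (C / L)"])
    show "max (L * C) (C / L) > 0" using L C(1) by (simp add: less_max_iff_disj)
    fix x :: real assume x: "x \<ge> 0" "\<alpha> * x powr m \<ge> 1"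
    have x0: "x > 0" using x by (cases "x = 0") auto
    let ?t = "\<alpha> * x powr m"
    let ?S = "\<Sum>n. ennreal (gamma_weight ?t (2 / m * real (Suc n)))"
    have k: "kernel x = ennreal (L * x powr (m - 2)) * ?S"
      unfolding L_def by (rule kernel_eq_suminf_gamma_weight[OF x0])
    have "kernel x \<le> ennreal (L * x powr (m - 2)) * ennreal (C * exp ?t)"
      unfolding k by (intro mult_left_mono C(2) x) auto
    also have "\<dots> = ennreal (L * C * growth x)"
      using L C(1) by (simp add: ennreal_mult'[symmetric] growth_def mult_ac)
    also have "\<dots> \<le> ennreal (max (L * C) (C / L) * growth x)"
      by (intro ennreal_leI mult_right_mono) auto
    finally show "kernel x \<le> ennreal (max (L * C) (C / L) * growth x)" .
    have "ennreal (growth x) = ennreal (x powr (m - 2)) * ennreal (exp ?t)"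
      by (simp add: growth_def ennreal_mult')
    also have "\<dots> \<le> ennreal (x powr (m - 2)) * (ennreal C * ?S)"
      by (intro mult_left_mono C(3) x) auto
    also have "\<dots> = ennreal (C / L) * kernel x"
    proof -
      have "ennreal (x powr (m - 2)) * ennreal C = ennreal (C / L) * ennreal (L * x powr (m - 2))"
        using L C(1) by (simp add: ennreal_mult[symmetric])
      thus ?thesis unfolding k by (metis mult.assoc)
    qed
    also have "\<dots> \<le> ennreal (max (L * C) (C / L)) * kernel x"
      by (intro mult_right_mono ennreal_leI) auto
    finally show "ennreal (growth x) \<le> ennreal (max (L * C) (C / L)) * kernel x" .
  qed
qed

text \<open>The radius from which on \<open>\<alpha> x\<^sup>m \<ge> 1\<close>, that is, from which the kernel is comparable to its growth.\<close>

definition threshold :: real where "threshold = \<alpha> powr (- 1 / m)"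

lemma threshold_pos: "threshold > 0" using \<alpha> by (simp add: threshold_def)

lemma threshold_iff:
  assumes "x \<ge> 0"
  shows "\<alpha> * x powr m \<ge> 1 \<longleftrightarrow> x \<ge> threshold"
proof -
  have e: "\<alpha> * threshold powr m = 1"
    using m \<alpha> by (simp add: threshold_def powr_powr powr_neg_one)
  show ?thesis
  proof
    assume "x \<ge> threshold"
    hence "threshold powr m \<le> x powr m"
      using m threshold_pos by (intro powr_mono2) auto
    thus "\<alpha> * x powr m \<ge> 1" using e \<alpha> mult_left_mono[of "threshold powr m" "x powr m" \<alpha>] by simp
  next
    assume *: "\<alpha> * x powr m \<ge> 1"
    show "x \<ge> threshold"
    proof (rule ccontr)
      assume "\<not> x \<ge> threshold"
      hence "x powr m < threshold powr m"
        using m assms by (intro powr_less_mono2) auto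
      hence "\<alpha> * x powr m < \<alpha> * threshold powr m" using \<alpha> by simp
      thus False using * e by simp
    qed
  qed
qed

lemma kernel_finite: "x \<ge> 0 \<Longrightarrow> kernel x < \<infinity>"
proof -
  assume x: "x \<ge> 0"
  obtain C where C: "\<And>x. x \<ge> 0 \<Longrightarrow> \<alpha> * x powr m \<ge> 1 \<Longrightarrow> kernel x \<le> ennreal (C * growth x)"
    by (rule kernel_comparable_growth) blast
  have "kernel x \<le> kernel (max x threshold)"
    using x by (intro kernel_mono) auto
  also have "\<dots> \<le> ennreal (C * growth (max x threshold))"
    using x threshold_pos by (intro C) (auto simp: threshold_iff)
  finally show ?thesis by (simp add: order_le_less_trans)
qed

lemma powr_m_minus_2:
  assumes "x > 0"
  shows "x powr (m - 2) = \<alpha> powr (2 / m - 1) * (\<alpha> * x powr m) powr (1 - 2 / m)"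
proof -
  have "(\<alpha> * x powr m) powr (1 - 2 / m) = \<alpha> powr (1 - 2 / m) * x powr (m - 2)"
    using assms \<alpha> m by (simp add: powr_mult powr_powr algebra_simps)
  moreover have "\<alpha> powr (2 / m - 1) * \<alpha> powr (1 - 2 / m) = 1"
    using \<alpha> by (simp add: powr_add[symmetric])
  ultimately show ?thesis by simp
qed

text \<open>This bound and the next absorb the power \<open>x\<^bsup>m-2\<^esup>\<close> into the exponential, at the price of changing
the constant in the exponent. They hold for all radii and are what the affinity criterion needs.\<close>

lemma kernel_crude_upper:
  obtains C where "C > 0" "\<And>x. x \<ge> 0 \<Longrightarrow> kernel x \<le> ennreal (C * exp (2 * \<alpha> * x powr m))"
proof -
  obtain C where C: "C > 0" "\<And>x. x \<ge> 0 \<Longrightarrow> \<alpha> * x powr m \<ge> 1 \<Longrightarrow> kernel x \<le> ennreal (C * growth x)"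
    by (rule kernel_comparable_growth) blast
  define D where "D = enn2real (kernel threshold) + C * \<alpha> powr (2 / m - 1)"
  have D: "D > 0" using C(1) \<alpha> by (simp add: D_def add_nonneg_pos)
  show thesis
  proof (rule that[OF D])
    fix x :: real assume x: "x \<ge> 0"
    show "kernel x \<le> ennreal (D * exp (2 * \<alpha> * x powr m))"
    proof (cases "x \<ge> threshold")
      case True
      define t where "t = \<alpha> * x powr m"
      have t: "t \<ge> 1" using True x by (simp add: t_def threshold_iff)
      have x0: "x > 0" using True threshold_pos by simp
      have "t powr (1 - 2 / m) \<le> t powr 1" using t m by (intro powr_mono) auto
      also have "\<dots> \<le> exp t" proof -
        have "t powr 1 = t" using t by simp
        thus ?thesis using exp_ge_add_one_self[of t] by linarith
      qed
      finally have "growth x \<le> \<alpha> powr (2 / m - 1) * exp t * exp t"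
        unfolding growth_def powr_m_minus_2[OF x0] t_def[symmetric]
        by (intro mult_right_mono mult_left_mono) auto
      also have "\<dots> = \<alpha> powr (2 / m - 1) * exp (2 * t)" by (simp add: exp_add[symmetric])
      finally have "C * growth x \<le> C * (\<alpha> powr (2 / m - 1) * exp (2 * t))"
        using C(1) by (intro mult_left_mono) auto
      also have "\<dots> \<le> D * exp (2 * t)"
        by (simp add: D_def mult.assoc[symmetric])
      finally have "C * growth x \<le> D * exp (2 * \<alpha> * x powr m)" by (simp add: t_def mult.assoc)
      hence "ennreal (C * growth x) \<le> ennreal (D * exp (2 * \<alpha> * x powr m))" by (rule ennreal_leI)
      thus ?thesis using C(2)[OF x] True x by (meson order_trans threshold_iff)
    next
      case False
      hence "kernel x \<le> kernel threshold" using x by (intro kernel_mono) auto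
      also have "\<dots> = ennreal (enn2real (kernel threshold))"
        using kernel_finite[of threshold] threshold_pos by simp
      also have "\<dots> \<le> ennreal (D * exp (2 * \<alpha> * x powr m))"
      proof (rule ennreal_leI)
        have "enn2real (kernel threshold) \<le> D * 1" using C(1) by (simp add: D_def)
        also have "\<dots> \<le> D * exp (2 * \<alpha> * x powr m)" using D \<alpha> by (intro mult_left_mono) auto
        finally show "enn2real (kernel threshold) \<le> D * exp (2 * \<alpha> * x powr m)" .
      qed
      finally show ?thesis .
    qed
  qed
qed

lemma kernel_crude_lower:
  obtains C where "C > 0" "\<And>x. x \<ge> 0 \<Longrightarrow> ennreal (exp (\<alpha> / 2 * x powr m)) \<le> ennreal C * kernel x"
proof -
  obtain C where C: "C > 0" "\<And>x. x \<ge> 0 \<Longrightarrow> \<alpha> * x powr m \<ge> 1 \<Longrightarrow> ennreal (growth x) \<le> ennreal C * kernel x"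
    by (rule kernel_comparable_growth) blast
  define B where "B = (2 / m / (1 / 2)) powr (2 / m) * \<alpha> powr (1 - 2 / m)"
  have B: "B > 0" using m \<alpha> by (simp add: B_def)
  \<comment> \<open>the first summand serves radii below the threshold, the second the other ones\<close>
  define D where "D = exp (1 / 2) + B * C"
  have D: "D > 0" using B C(1) by (simp add: D_def add_pos_pos)
  show thesis
  proof (rule that[OF D])
    fix x :: real assume x: "x \<ge> 0"
    define t where "t = \<alpha> * x powr m"
    show "ennreal (exp (\<alpha> / 2 * x powr m)) \<le> ennreal D * kernel x"
    proof (cases "x \<ge> threshold")
      case True
      have t: "t \<ge> 1" using True x by (simp add: t_def threshold_iff)
      have x0: "x > 0" using True threshold_pos by simp
      have "t powr (2 / m - 1) \<le> t powr (2 / m)" using t by (intro powr_mono) auto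
      also have "\<dots> \<le> (2 / m / (1 / 2)) powr (2 / m) * exp (1 / 2 * t)"
        using m t by (intro powr_le_exp) auto
      finally have p: "t powr (2 / m - 1) \<le> (2 / m / (1 / 2)) powr (2 / m) * exp (t / 2)" by simp
      have inv: "\<alpha> powr (1 - 2 / m) * \<alpha> powr (2 / m - 1) = 1"
        using \<alpha> by (simp add: powr_add[symmetric])
      have "exp (t / 2) = t powr (2 / m - 1) * t powr (1 - 2 / m) * exp (t / 2)"
        using t by (simp add: powr_add[symmetric])
      also have "\<dots> \<le> ((2 / m / (1 / 2)) powr (2 / m) * exp (t / 2)) * t powr (1 - 2 / m) * exp (t / 2)"
        by (intro mult_right_mono p) auto
      also have "\<dots> = (2 / m / (1 / 2)) powr (2 / m) * t powr (1 - 2 / m) * (exp (t / 2) * exp (t / 2))"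
        by (simp only: mult_ac)
      also have "exp (t / 2) * exp (t / 2) = exp t" by (simp add: exp_add[symmetric])
      also have "(2 / m / (1 / 2)) powr (2 / m) * t powr (1 - 2 / m) * exp t = 
        (2 / m / (1 / 2)) powr (2 / m) * t powr (1 - 2 / m) * exp t * (\<alpha> powr (1 - 2 / m) * \<alpha> powr (2 / m - 1))"
        by (simp only: inv mult_1_right)
      also have "\<dots> = B * growth x"
        unfolding growth_def powr_m_minus_2[OF x0] t_def[symmetric] B_def by (simp only: mult_ac)
      finally have "ennreal (exp (t / 2)) \<le> ennreal (B * growth x)" by (rule ennreal_leI)
      also have "\<dots> = ennreal B * ennreal (growth x)" using B by (simp add: ennreal_mult)
      also have "\<dots> \<le> ennreal B * (ennreal C * kernel x)"
        using C(2)[of x] x True by (intro mult_left_mono) (auto simp: threshold_iff)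
      also have "\<dots> = ennreal (B * C) * kernel x" using B C(1) by (simp add: ennreal_mult mult.assoc)
      also have "\<dots> \<le> ennreal D * kernel x" by (intro mult_right_mono ennreal_leI) (auto simp: D_def)
      finally show ?thesis by (simp add: t_def)
    next
      case False
      hence "t \<le> 1" using threshold_iff[OF x] by (simp add: t_def)
      hence "\<alpha> / 2 * x powr m \<le> 1 / 2" by (simp add: t_def)
      hence "exp (\<alpha> / 2 * x powr m) \<le> exp (1 / 2)" by (rule exp_le_cancel_iff[THEN iffD2])
      also have "\<dots> \<le> D" unfolding D_def using mult_pos_pos[OF B C(1)] by linarith
      finally have "exp (\<alpha> / 2 * x powr m) \<le> D" .
      hence "ennreal (exp (\<alpha> / 2 * x powr m)) \<le> ennreal D * 1" by (simp add: ennreal_leI)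
      also have "\<dots> \<le> ennreal D * kernel x" by (intro mult_left_mono kernel_ge_1) auto
      finally show ?thesis .
    qed
  qed
qed

section \<open>Orthonormal bases\<close>

definition monomial :: "nat \<Rightarrow> complex \<Rightarrow> complex" where
  "monomial n z = z ^ n / complex_of_real (sqrt (monomial_sq_norm n))"

lemma cmod_monomial_sq: "(cmod (monomial n z))\<^sup>2 = cmod z ^ (2 * n) / monomial_sq_norm n"
  using monomial_sq_norm_pos[of n]
  by (simp add: monomial_def norm_divide norm_power power_divide power_mult[symmetric] mult.commute less_imp_le)

lemma holomorphic_monomial: "monomial n holomorphic_on UNIV"
  using monomial_sq_norm_pos[of n] unfolding monomial_def by (intro holomorphic_intros) auto

lemma sq_norm_monomial: "sq_norm (monomial n) = 1"
proof -
  have "sq_norm (monomial n) = (\<integral>\<^sup>+ z. ennreal (1 / monomial_sq_norm n) * ennreal (cmod z ^ (2 * n)) \<partial>\<mu>)"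
    unfolding sq_norm_def cmod_monomial_sq using monomial_sq_norm_pos[of n]
    by (intro nn_integral_cong) (simp add: ennreal_mult'[symmetric])
  also have "\<dots> = ennreal (1 / monomial_sq_norm n) * ennreal (monomial_sq_norm n)"
    by (subst nn_integral_cmult) (auto simp: nn_integral_monomial)
  also have "\<dots> = 1" using monomial_sq_norm_pos[of n] by (simp add: ennreal_mult'[symmetric])
  finally show ?thesis .
qed

text \<open>The Taylor remainder is again a power series, so Parseval's identity makes its squared norm the tail
of a convergent series.\<close>

lemma sq_norm_tail_small:
  assumes a: "\<And>z. (\<lambda>n. a n * z ^ n) sums f z" and fin: "sq_norm f < \<infinity>" and r: "r > 0"
  obtains N where "sq_norm (\<lambda>z. f z - (\<Sum>n<N. a n * z ^ n)) < ennreal r"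
proof -
  define b where "b n = (cmod (a n))\<^sup>2 * monomial_sq_norm n" for n
  have b0: "b n \<ge> 0" for n using monomial_sq_norm_pos[of n] by (simp add: b_def)
  have "(\<Sum>n. ennreal (b n)) \<noteq> top"
    using fin unfolding sq_norm_power_series[OF a] by (simp add: b_def)
  hence summ: "summable b" by (rule summable_suminf_not_top[OF b0])
  obtain N where N: "norm (\<Sum>i. b (i + N)) < r"
    using suminf_exist_split[OF r summ] by blast
  have ser: "(\<lambda>n. (if n < N then 0 else a n) * z ^ n) sums (f z - (\<Sum>n<N. a n * z ^ n))" for z
  proof -
    have "(\<lambda>n. if n \<in> {..<N} then a n * z ^ n else 0) sums (\<Sum>n<N. a n * z ^ n)"
      by (rule sums_If_finite_set) simp
    from sums_diff[OF a this] show ?thesis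
      by (rule back_subst[of "\<lambda>s. s sums _"]) (auto simp: fun_eq_iff)
  qed
  have "sq_norm (\<lambda>z. f z - (\<Sum>n<N. a n * z ^ n)) =
      (\<Sum>n. ennreal ((cmod (if n < N then 0 else a n))\<^sup>2 * monomial_sq_norm n))"
    by (rule sq_norm_power_series[OF ser])
  also have "\<dots> = (\<Sum>n. ennreal ((cmod (if n + N < N then 0 else a (n + N)))\<^sup>2 * monomial_sq_norm (n + N)))"
    by (subst suminf_offset[of _ N]) auto
  also have "\<dots> = (\<Sum>n. ennreal (b (n + N)))" by (simp add: b_def)
  also have "\<dots> = ennreal (\<Sum>i. b (i + N))"
    using summ b0 by (intro suminf_ennreal2) (auto simp: summable_iff_shift)
  also have "\<dots> < ennreal r" using N r by (intro ennreal_lessI) auto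
  finally show ?thesis by (rule that)
qed

lemma fock_onb_monomial: "fock_onb \<alpha> m monomial"
  unfolding fock_onb_def
proof (intro conjI allI ballI impI)
  show "monomial n \<in> fock_space \<alpha> m" for n
    by (simp add: mem_fock_space_iff holomorphic_monomial sq_norm_monomial)
  show "fock_inner \<alpha> m (monomial i) (monomial j) = (if i = j then 1 else 0)" for i j
  proof (cases "i = j")
    case True
    have "fock_inner \<alpha> m (monomial i) (monomial i) = (LINT z|\<mu>. complex_of_real ((cmod (monomial i z))\<^sup>2))"
      by (simp only: fock_inner_def complex_norm_square)
    also have "\<dots> = complex_of_real (LINT z|\<mu>. (cmod (monomial i z))\<^sup>2)"
      by (rule integral_complex_of_real)
    also have "(LINT z|\<mu>. (cmod (monomial i z))\<^sup>2) = 1"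
    proof -
      have "monomial i \<in> borel_measurable borel" by (rule holomorphic_measurable[OF holomorphic_monomial])
      hence "(LINT z|\<mu>. (cmod (monomial i z))\<^sup>2) = enn2real (sq_norm (monomial i))"
        unfolding sq_norm_def by (intro integral_eq_nn_integral) auto
      thus ?thesis by (simp add: sq_norm_monomial)
    qed
    finally show ?thesis using True by simp
  next
    case False
    let ?s = "1 / (sqrt (monomial_sq_norm i) * sqrt (monomial_sq_norm j))"
    have "fock_inner \<alpha> m (monomial i) (monomial j) = (LINT z|\<mu>. ?s *\<^sub>R (z ^ i * cnj (z ^ j)))"
      unfolding fock_inner_def monomial_def
      by (intro Bochner_Integration.integral_cong) (auto simp: scaleR_conv_of_real)
    also have "\<dots> = 0"
      using integral_monomials_orthogonal[of "\<lambda>_. ?s" i j] False by simp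
    finally show ?thesis using False by simp
  qed
  fix f \<epsilon> assume f: "f \<in> fock_space \<alpha> m" and \<epsilon>: "(\<epsilon>::real) > 0"
  obtain a where a: "\<And>z. (\<lambda>n. a n * z ^ n) sums f z"
    using f entire_power_series[of f] by (auto simp: mem_fock_space_iff)
  have fin: "sq_norm f < \<infinity>" using f by (simp add: mem_fock_space_iff)
  obtain N where N: "sq_norm (\<lambda>z. f z - (\<Sum>n<N. a n * z ^ n)) < ennreal (\<epsilon>\<^sup>2)"
    using sq_norm_tail_small[OF a fin, of "\<epsilon>\<^sup>2"] \<epsilon> by auto
  define g where "g z = f z - (\<Sum>n<N. (a n * complex_of_real (sqrt (monomial_sq_norm n))) * monomial n z)" for z
  have g: "g = (\<lambda>z. f z - (\<Sum>n<N. a n * z ^ n))"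
    unfolding g_def monomial_def using monomial_sq_norm_pos by (simp add: less_imp_neq[THEN not_sym])
  have "g holomorphic_on UNIV"
    unfolding g using f by (intro holomorphic_intros) (auto simp: mem_fock_space_iff)
  hence gF: "g \<in> fock_space \<alpha> m"
    using N unfolding mem_fock_space_iff g[symmetric] by (auto simp: less_top[symmetric] dest: order.strict_trans)
  have "ennreal ((fock_norm \<alpha> m g)\<^sup>2) < ennreal (\<epsilon>\<^sup>2)"
    using N unfolding g[symmetric] sq_norm_eq_fock_norm[OF gF] .
  hence "(fock_norm \<alpha> m g)\<^sup>2 < \<epsilon>\<^sup>2" by (subst (asm) ennreal_less_iff) auto
  hence "fock_norm \<alpha> m g < \<epsilon>" using \<epsilon> by (intro power_less_imp_less_base[of _ 2 \<epsilon>]) auto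
  thus "\<exists>N c. fock_norm \<alpha> m (\<lambda>z. f z - (\<Sum>n<N. c n * monomial n z)) < \<epsilon>"
    unfolding g_def by (intro exI[of _ N] exI[of _ "\<lambda>n. a n * complex_of_real (sqrt (monomial_sq_norm n))"])
qed

lemma sq_norm_add_le:
  assumes "f holomorphic_on UNIV" "g holomorphic_on UNIV"
  shows "sq_norm (\<lambda>z. f z + g z) \<le> 2 * sq_norm f + 2 * sq_norm g"
proof -
  note [measurable] = assms[THEN holomorphic_measurable]
  have "sq_norm (\<lambda>z. f z + g z) \<le> (\<integral>\<^sup>+ z. 2 * ennreal ((cmod (f z))\<^sup>2) + 2 * ennreal ((cmod (g z))\<^sup>2) \<partial>\<mu>)"
    unfolding sq_norm_def
  proof (rule nn_integral_mono)
    fix z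
    have "(cmod (f z + g z))\<^sup>2 \<le> (cmod (f z) + cmod (g z))\<^sup>2"
      by (intro power_mono norm_triangle_ineq) auto
    also have "\<dots> \<le> 2 * (cmod (f z))\<^sup>2 + 2 * (cmod (g z))\<^sup>2"
      using sum_squares_bound[of "cmod (f z)" "cmod (g z)"] by (simp add: power2_sum)
    finally have "ennreal ((cmod (f z + g z))\<^sup>2) \<le> ennreal (2 * (cmod (f z))\<^sup>2 + 2 * (cmod (g z))\<^sup>2)"
      by (rule ennreal_leI)
    thus "ennreal ((cmod (f z + g z))\<^sup>2) \<le> 2 * ennreal ((cmod (f z))\<^sup>2) + 2 * ennreal ((cmod (g z))\<^sup>2)"
      by (simp add: ennreal_mult')
  qed
  also have "\<dots> = 2 * sq_norm f + 2 * sq_norm g"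
    unfolding sq_norm_def by (simp add: nn_integral_add nn_integral_cmult)
  finally show ?thesis .
qed

lemma sq_norm_orthonormal_sum:
  assumes onb: "fock_onb \<alpha> m e"
  shows "sq_norm (\<lambda>z. \<Sum>n<N. c n * e n z) = ennreal (\<Sum>n<N. (cmod (c n))\<^sup>2)"
proof -
  have eF: "e n \<in> fock_space \<alpha> m" for n using onb by (simp add: fock_onb_def)
  have inner: "(LINT z|\<mu>. e i z * cnj (e j z)) = (if i = j then 1 else 0)" for i j
    using onb by (simp add: fock_onb_def fock_inner_def)
  have meas [measurable]: "e n \<in> borel_measurable borel" for n
    using eF[of n] holomorphic_measurable by (auto simp: mem_fock_space_iff)
  have sq: "integrable \<mu> (\<lambda>z. (cmod (e n z))\<^sup>2)" for n
    using eF[of n] by (simp add: fock_space_def)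
  have int: "integrable \<mu> (\<lambda>z. e i z * cnj (e j z))" for i j
  proof (rule Bochner_Integration.integrable_bound)
    show "integrable \<mu> (\<lambda>z. (cmod (e i z))\<^sup>2 + (cmod (e j z))\<^sup>2)"
      by (intro Bochner_Integration.integrable_add sq)
    show "(\<lambda>z. e i z * cnj (e j z)) \<in> borel_measurable \<mu>" by simp
    show "AE z in \<mu>. norm (e i z * cnj (e j z)) \<le> norm ((cmod (e i z))\<^sup>2 + (cmod (e j z))\<^sup>2)"
    proof (intro AE_I2)
      fix z
      have "2 * cmod (e i z) * cmod (e j z) \<le> (cmod (e i z))\<^sup>2 + (cmod (e j z))\<^sup>2"
        by (rule sum_squares_bound)
      moreover have "0 \<le> cmod (e i z) * cmod (e j z)" by simp
      ultimately show "norm (e i z * cnj (e j z)) \<le> norm ((cmod (e i z))\<^sup>2 + (cmod (e j z))\<^sup>2)"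
        unfolding norm_mult complex_mod_cnj real_norm_def by linarith
    qed
  qed
  let ?g = "\<lambda>z. \<Sum>n<N. c n * e n z"
  have expand: "complex_of_real ((cmod (?g z))\<^sup>2) = (\<Sum>i<N. \<Sum>j<N. (c i * cnj (c j)) * (e i z * cnj (e j z)))" for z
  proof -
    have "complex_of_real ((cmod (?g z))\<^sup>2) = ?g z * cnj (?g z)"
      by (rule complex_norm_square)
    thus ?thesis by (simp add: cnj_sum sum_product mult_ac)
  qed
  have intg: "integrable \<mu> (\<lambda>z. complex_of_real ((cmod (?g z))\<^sup>2))"
    unfolding expand by (intro Bochner_Integration.integrable_sum integrable_mult_right int)
  have "complex_of_real (LINT z|\<mu>. (cmod (?g z))\<^sup>2) = (LINT z|\<mu>. complex_of_real ((cmod (?g z))\<^sup>2))"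
    by (rule integral_complex_of_real[symmetric])
  also have "\<dots> = (\<Sum>i<N. \<Sum>j<N. (c i * cnj (c j)) * (LINT z|\<mu>. e i z * cnj (e j z)))"
    unfolding expand
    by (simp only: Bochner_Integration.integral_sum Bochner_Integration.integrable_sum
        integrable_mult_right int integral_mult_right_zero)
  also have "\<dots> = (\<Sum>i<N. \<Sum>j<N. if i = j then c i * cnj (c i) else 0)"
    by (intro sum.cong refl) (simp add: inner)
  also have "\<dots> = (\<Sum>i<N. c i * cnj (c i))" by simp
  also have "\<dots> = complex_of_real (\<Sum>n<N. (cmod (c n))\<^sup>2)"
    by (simp only: complex_norm_square of_real_sum)
  finally have "(LINT z|\<mu>. (cmod (?g z))\<^sup>2) = (\<Sum>n<N. (cmod (c n))\<^sup>2)"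
    by (simp only: of_real_eq_iff)
  moreover have "integrable \<mu> (\<lambda>z. (cmod (?g z))\<^sup>2)"
    using integrable_Re[OF intg] by simp
  ultimately show ?thesis unfolding sq_norm_def by (simp add: nn_integral_eq_integral)
qed

text \<open>Let \<open>p\<close> be a partial sum of the Taylor series of the kernel function at \<open>w\<close>. Its value at \<open>w\<close> and its
squared norm both equal the partial sum \<open>F\<close> of \<open>K(|w|)\<close>. A linear combination \<open>g\<close> of the
basis close to \<open>p\<close> satisfies \<open>|g w|\<^sup>2 \<le> \<parallel>g\<parallel>\<^sup>2 E\<close> with \<open>E\<close> the sum of \<open>|e\<^sub>n w|\<^sup>2\<close>, by the Cauchy-Schwarz
inequality, and in the limit \<open>F\<^sup>2 \<le> 4 F E\<close>. The factor 4 comes from splitting squares of sums by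
\<open>(x + y)\<^sup>2 \<le> 2 x\<^sup>2 + 2 y\<^sup>2\<close> twice; it is harmless, as the estimate serves to prove finiteness.\<close>

lemma kernel_le_onb:
  assumes onb: "fock_onb \<alpha> m e"
  shows "kernel (cmod w) \<le> 4 * (\<Sum>n. ennreal ((cmod (e n w))\<^sup>2))"
proof (cases "(\<Sum>n. ennreal ((cmod (e n w))\<^sup>2)) = \<infinity>")
  case True
  thus ?thesis by (simp add: ennreal_mult_eq_top_iff)
next
  case False
  define E where "E = enn2real (\<Sum>n. ennreal ((cmod (e n w))\<^sup>2))"
  have E: "(\<Sum>n. ennreal ((cmod (e n w))\<^sup>2)) = ennreal E" "E \<ge> 0"
    using False by (auto simp: E_def less_top)
  define k where "k = enn2real (kernel (cmod w))"
  have k: "kernel (cmod w) = ennreal k" "k \<ge> 0"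
    using kernel_finite[of "cmod w"] by (auto simp: k_def)
  have eF: "e n \<in> fock_space \<alpha> m" for n using onb by (simp add: fock_onb_def)
  have part: "(\<Sum>n<N. cmod w ^ (2 * n) / monomial_sq_norm n) \<le> 4 * E" for N
  proof -
    define a where "a n = (if n < N then cnj w ^ n / monomial_sq_norm n else 0)" for n
    define F where "F = (\<Sum>n<N. cmod w ^ (2 * n) / monomial_sq_norm n)"
    define p where "p z = (\<Sum>n<N. a n * z ^ n)" for z
    have F0: "F \<ge> 0" unfolding F_def using monomial_sq_norm_pos by (intro sum_nonneg) (auto simp: less_imp_le)
    have "(\<lambda>n. a n * z ^ n) sums p z" for z
      using sums_If_finite_set[of "{..<N}" "\<lambda>n. a n * z ^ n"] unfolding p_def
      by (rule back_subst[of "\<lambda>s. s sums _"]) (auto simp: fun_eq_iff a_def)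
    hence "sq_norm p = (\<Sum>n. ennreal ((cmod (a n))\<^sup>2 * monomial_sq_norm n))"
      by (rule sq_norm_power_series)
    also have "\<dots> = (\<Sum>n<N. ennreal ((cmod (a n))\<^sup>2 * monomial_sq_norm n))"
      by (rule suminf_finite) (auto simp: a_def)
    also have "\<dots> = ennreal F"
    proof (subst sum_ennreal, goal_cases)
      case 2
      have "(cmod (a n))\<^sup>2 * monomial_sq_norm n = cmod w ^ (2 * n) / monomial_sq_norm n" if "n < N" for n
        using that monomial_sq_norm_pos[of n]
        by (simp add: a_def norm_divide norm_power power2_eq_square mult_2 power_add)
      thus ?case by (simp add: F_def)
    qed (use monomial_sq_norm_pos in \<open>simp add: less_imp_le\<close>)
    finally have pF: "sq_norm p = ennreal F" .
    have ph: "p holomorphic_on UNIV" unfolding p_def by (intro holomorphic_intros)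
    have pfock: "p \<in> fock_space \<alpha> m" using ph pF by (simp add: mem_fock_space_iff)
    have "p w = complex_of_real F"
    proof -
      have "a n * w ^ n = complex_of_real (cmod w ^ (2 * n) / monomial_sq_norm n)" if "n < N" for n
      proof -
        have "cnj w ^ n * w ^ n = complex_of_real ((cmod w)\<^sup>2) ^ n"
          unfolding complex_norm_square by (simp add: power_mult_distrib mult.commute)
        thus ?thesis using that by (simp add: a_def power_mult)
      qed
      thus ?thesis by (simp add: p_def F_def)
    qed
    hence pw: "cmod (p w) = F" using F0 by simp
    have main: "F\<^sup>2 \<le> 4 * F * E + \<delta>" if \<delta>: "\<delta> > 0" for \<delta>
    proof -
      \<comment> \<open>chosen so that the total error below is at most \<open>\<delta>\<close>\<close>
      define \<epsilon> where "\<epsilon> = sqrt (\<delta> / (4 * E + 2 * k + 1))"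
      have den: "4 * E + 2 * k + 1 > 0" using E k by linarith
      have \<epsilon>: "\<epsilon> > 0" "\<epsilon>\<^sup>2 = \<delta> / (4 * E + 2 * k + 1)"
        using \<delta> den by (auto simp: \<epsilon>_def)
      obtain M c where Mc: "fock_norm \<alpha> m (\<lambda>z. p z - (\<Sum>n<M. c n * e n z)) < \<epsilon>"
        using onb pfock \<epsilon>(1) unfolding fock_onb_def by meson
      define g where "g z = (\<Sum>n<M. c n * e n z)" for z
      define h where "h z = p z - g z" for z
      have gh: "g holomorphic_on UNIV" 
        unfolding g_def using eF by (intro holomorphic_intros) (auto simp: mem_fock_space_iff)
      have hh: "h holomorphic_on UNIV" unfolding h_def by (intro holomorphic_intros ph gh)
      define G where "G = (\<Sum>n<M. (cmod (c n))\<^sup>2)"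
      have G0: "G \<ge> 0" by (simp add: G_def sum_nonneg)
      have gG: "sq_norm g = ennreal G"
        unfolding g_def G_def by (rule sq_norm_orthonormal_sum[OF onb])
      have "sq_norm h < \<infinity>"
      proof -
        have "h = (\<lambda>z. p z + (-1) * g z)" by (simp add: h_def fun_eq_iff)
        hence "sq_norm h \<le> 2 * sq_norm p + 2 * sq_norm (\<lambda>z. (-1) * g z)"
          using sq_norm_add_le[OF ph holomorphic_on_mult[OF holomorphic_on_const gh], of "-1"] by simp
        also have "sq_norm (\<lambda>z. (-1) * g z) = sq_norm g" by (simp add: sq_norm_def)
        also have "2 * sq_norm p + 2 * sq_norm g < \<infinity>"
          unfolding pF gG by (simp add: ennreal_mult_less_top)
        finally show ?thesis .
      qed
      hence hfock: "h \<in> fock_space \<alpha> m" using hh by (simp add: mem_fock_space_iff)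
      have hn: "fock_norm \<alpha> m h < \<epsilon>" using Mc unfolding h_def g_def .
      have h2: "(fock_norm \<alpha> m h)\<^sup>2 \<le> \<epsilon>\<^sup>2"
        using hn by (intro power_mono) (auto simp: fock_norm_def)
      have hs: "sq_norm h \<le> ennreal (\<epsilon>\<^sup>2)"
        unfolding sq_norm_eq_fock_norm[OF hfock] by (rule ennreal_leI[OF h2])
      have GF: "G \<le> 2 * F + 2 * \<epsilon>\<^sup>2"
      proof -
        have "g = (\<lambda>z. p z + (-1) * h z)" by (simp add: h_def fun_eq_iff)
        hence "sq_norm g \<le> 2 * sq_norm p + 2 * sq_norm (\<lambda>z. (-1) * h z)"
          using sq_norm_add_le[OF ph holomorphic_on_mult[OF holomorphic_on_const hh], of "-1"] by simp
        also have "sq_norm (\<lambda>z. (-1) * h z) = sq_norm h" by (simp add: sq_norm_def)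
        also have "2 * sq_norm p + 2 * sq_norm h \<le> 2 * ennreal F + 2 * ennreal (\<epsilon>\<^sup>2)"
          unfolding pF by (intro add_left_mono mult_left_mono hs) auto
        also have "\<dots> = ennreal (2 * F + 2 * \<epsilon>\<^sup>2)"
          using F0 by (simp add: ennreal_mult')
        finally show ?thesis unfolding gG using F0 by (subst (asm) ennreal_le_iff) auto
      qed
      have hw: "(cmod (h w))\<^sup>2 \<le> \<epsilon>\<^sup>2 * k"
      proof -
        have "ennreal ((cmod (h w))\<^sup>2) \<le> sq_norm h * kernel (cmod w)"
          by (rule cmod_sq_le_kernel[OF hh])
        also have "\<dots> \<le> ennreal (\<epsilon>\<^sup>2) * ennreal k" unfolding k(1) by (intro mult_right_mono hs) auto
        also have "\<dots> = ennreal (\<epsilon>\<^sup>2 * k)" using k(2) by (simp add: ennreal_mult)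
        finally show ?thesis using k(2) by (simp add: ennreal_le_iff)
      qed
      have gw: "(cmod (g w))\<^sup>2 \<le> G * E"
      proof -
        have "cmod (g w) \<le> (\<Sum>n<M. cmod (c n) * cmod (e n w))"
          unfolding g_def by (rule order_trans[OF norm_sum]) (simp add: norm_mult)
        hence "(cmod (g w))\<^sup>2 \<le> (\<Sum>n<M. cmod (c n) * cmod (e n w))\<^sup>2"
          by (intro power_mono) auto
        also have "\<dots> \<le> G * (\<Sum>n<M. (cmod (e n w))\<^sup>2)"
          unfolding G_def by (rule Cauchy_Schwarz_ineq_sum)
        also have "\<dots> \<le> G * E"
        proof (intro mult_left_mono G0)
          have "ennreal (\<Sum>n<M. (cmod (e n w))\<^sup>2) \<le> ennreal E"
            unfolding E(1)[symmetric] by (rule ennreal_sum_le_suminf) simp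
          thus "(\<Sum>n<M. (cmod (e n w))\<^sup>2) \<le> E" using E(2) by (simp add: ennreal_le_iff)
        qed
        finally show ?thesis .
      qed
      have "F \<le> cmod (g w) + cmod (h w)"
        using norm_triangle_ineq[of "g w" "h w"] pw by (simp add: h_def)
      hence "F\<^sup>2 \<le> (cmod (g w) + cmod (h w))\<^sup>2" using F0 by (intro power_mono) auto
      also have "\<dots> \<le> 2 * (cmod (g w))\<^sup>2 + 2 * (cmod (h w))\<^sup>2"
        using sum_squares_bound[of "cmod (g w)" "cmod (h w)"] by (simp add: power2_sum)
      also have "\<dots> \<le> 2 * ((2 * F + 2 * \<epsilon>\<^sup>2) * E) + 2 * (\<epsilon>\<^sup>2 * k)"
        using gw hw mult_right_mono[OF GF E(2)] by linarith
      also have "\<dots> = 4 * F * E + \<epsilon>\<^sup>2 * (4 * E + 2 * k)" by (simp add: algebra_simps)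
      also have "\<epsilon>\<^sup>2 * (4 * E + 2 * k) \<le> \<epsilon>\<^sup>2 * (4 * E + 2 * k + 1)" by (intro mult_left_mono) auto
      also have "\<dots> = \<delta>" using den \<epsilon>(2) by simp
      finally show ?thesis by simp
    qed
    have "F\<^sup>2 \<le> 4 * F * E" by (rule field_le_epsilon) (use main in simp)
    hence "F * F \<le> F * (4 * E)" by (simp add: power2_eq_square mult_ac)
    hence "F \<le> 4 * E" using F0 E(2) by (cases "F = 0") (auto simp: mult_le_cancel_left)
    thus ?thesis by (simp add: F_def)
  qed
  have "kernel (cmod w) = (SUP N. \<Sum>n<N. ennreal (cmod w ^ (2 * n) / monomial_sq_norm n))"
    unfolding kernel_def by (rule suminf_eq_SUP)
  also have "\<dots> \<le> ennreal (4 * E)"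
  proof (rule SUP_least)
    fix N
    have "(\<Sum>n<N. ennreal (cmod w ^ (2 * n) / monomial_sq_norm n)) =
        ennreal (\<Sum>n<N. cmod w ^ (2 * n) / monomial_sq_norm n)"
      using monomial_sq_norm_pos by (intro sum_ennreal) (simp add: less_imp_le)
    thus "(\<Sum>n<N. ennreal (cmod w ^ (2 * n) / monomial_sq_norm n)) \<le> ennreal (4 * E)"
      using part[of N] by (simp add: ennreal_leI)
  qed
  also have "\<dots> = 4 * (\<Sum>n. ennreal ((cmod (e n w))\<^sup>2))"
    using E by (simp add: ennreal_mult')
  finally show ?thesis .
qed

section \<open>The Hilbert-Schmidt condition as an integral\<close>

lemma kernel_measurable [measurable]: "kernel \<in> borel_measurable borel"
  unfolding kernel_def by measurable

text \<open>The square of the Hilbert-Schmidt norm of the weighted composition operator, by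
\<open>hs_integral_eq_suminf\<close>.\<close>

definition hs_integral :: "(complex \<Rightarrow> complex) \<Rightarrow> (complex \<Rightarrow> complex) \<Rightarrow> ennreal" where
  "hs_integral \<psi> \<phi> = (\<integral>\<^sup>+ z. ennreal ((cmod (\<psi> z))\<^sup>2) * kernel (cmod (\<phi> z)) \<partial>\<mu>)"

lemma holomorphic_weighted_comp:
  assumes "\<psi> holomorphic_on UNIV" "\<phi> holomorphic_on UNIV" "f holomorphic_on UNIV"
  shows "weighted_comp \<psi> \<phi> f holomorphic_on UNIV"
proof -
  have "(f \<circ> \<phi>) holomorphic_on UNIV"
    by (rule holomorphic_on_compose_gen[OF assms(2,3)]) auto
  thus ?thesis using assms(1) unfolding weighted_comp_def by (auto intro!: holomorphic_intros simp: o_def)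
qed

lemma suminf_weighted_comp_monomial:
  "(\<Sum>n. ennreal ((cmod (weighted_comp \<psi> \<phi> (monomial n) z))\<^sup>2)) =
    ennreal ((cmod (\<psi> z))\<^sup>2) * kernel (cmod (\<phi> z))"
proof -
  have "ennreal ((cmod (weighted_comp \<psi> \<phi> (monomial n) z))\<^sup>2) =
      ennreal ((cmod (\<psi> z))\<^sup>2) * ennreal (cmod (\<phi> z) ^ (2 * n) / monomial_sq_norm n)" for n
    unfolding weighted_comp_def norm_mult power_mult_distrib cmod_monomial_sq
    by (rule ennreal_mult') simp
  thus ?thesis unfolding kernel_def by simp
qed

lemma hs_integral_eq_suminf:
  assumes "\<psi> holomorphic_on UNIV" "\<phi> holomorphic_on UNIV"
  shows "hs_integral \<psi> \<phi> = (\<Sum>n. sq_norm (weighted_comp \<psi> \<phi> (monomial n)))"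
proof -
  have [measurable]: "weighted_comp \<psi> \<phi> (monomial n) \<in> borel_measurable borel" for n
    by (intro holomorphic_measurable holomorphic_weighted_comp assms holomorphic_monomial)
  show ?thesis
    unfolding hs_integral_def sq_norm_def suminf_weighted_comp_monomial[symmetric]
    by (rule nn_integral_suminf) simp
qed

text \<open>The operator norm is at most the Hilbert-Schmidt norm: bound \<open>f\<close> at the point \<open>\<phi> z\<close> by the kernel and
integrate.\<close>

lemma sq_norm_weighted_comp_le:
  assumes "\<psi> holomorphic_on UNIV" "\<phi> holomorphic_on UNIV" "f holomorphic_on UNIV"
  shows "sq_norm (weighted_comp \<psi> \<phi> f) \<le> hs_integral \<psi> \<phi> * sq_norm f"
proof -
  note [measurable] = assms[THEN holomorphic_measurable]
  have "sq_norm (weighted_comp \<psi> \<phi> f) \<le>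
      (\<integral>\<^sup>+ z. (ennreal ((cmod (\<psi> z))\<^sup>2) * kernel (cmod (\<phi> z))) * sq_norm f \<partial>\<mu>)"
    unfolding sq_norm_def[of "weighted_comp \<psi> \<phi> f"]
  proof (rule nn_integral_mono)
    fix z
    have "ennreal ((cmod (weighted_comp \<psi> \<phi> f z))\<^sup>2) = ennreal ((cmod (\<psi> z))\<^sup>2) * ennreal ((cmod (f (\<phi> z)))\<^sup>2)"
      by (simp add: weighted_comp_def norm_mult power_mult_distrib ennreal_mult')
    also have "\<dots> \<le> ennreal ((cmod (\<psi> z))\<^sup>2) * (sq_norm f * kernel (cmod (\<phi> z)))"
      by (intro mult_left_mono cmod_sq_le_kernel assms) auto
    finally show "ennreal ((cmod (weighted_comp \<psi> \<phi> f z))\<^sup>2) \<le>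
        (ennreal ((cmod (\<psi> z))\<^sup>2) * kernel (cmod (\<phi> z))) * sq_norm f"
      by (simp only: mult_ac)
  qed
  also have "\<dots> = hs_integral \<psi> \<phi> * sq_norm f"
    unfolding hs_integral_def by (rule nn_integral_multc) simp
  finally show ?thesis .
qed

text \<open>The normalised monomials serve as the orthonormal basis.\<close>

lemma hilbert_schmidt_if_hs_integral_finite:
  assumes psi: "\<psi> holomorphic_on UNIV" and phi: "\<phi> holomorphic_on UNIV"
    and fin: "hs_integral \<psi> \<phi> < \<infinity>"
  shows "fock_hilbert_schmidt \<alpha> m (weighted_comp \<psi> \<phi>)"
proof -
  let ?T = "weighted_comp \<psi> \<phi>"
  define J where "J = enn2real (hs_integral \<psi> \<phi>)"
  have J: "hs_integral \<psi> \<phi> = ennreal J" "J \<ge> 0" using fin by (auto simp: J_def)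
  have maps: "?T f \<in> fock_space \<alpha> m" if f: "f \<in> fock_space \<alpha> m" for f
  proof -
    have fh: "f holomorphic_on UNIV" using f by (simp add: mem_fock_space_iff)
    have "sq_norm (?T f) \<le> hs_integral \<psi> \<phi> * sq_norm f"
      by (rule sq_norm_weighted_comp_le[OF psi phi fh])
    also have "\<dots> < \<infinity>" using fin f by (simp add: mem_fock_space_iff ennreal_mult_less_top)
    finally show ?thesis
      using holomorphic_weighted_comp[OF psi phi fh] by (simp add: mem_fock_space_iff)
  qed
  have bounded: "fock_norm \<alpha> m (?T f) \<le> sqrt J * fock_norm \<alpha> m f" if f: "f \<in> fock_space \<alpha> m" for f
  proof (rule power2_le_imp_le)
    have fh: "f holomorphic_on UNIV" using f by (simp add: mem_fock_space_iff)
    have "ennreal ((fock_norm \<alpha> m (?T f))\<^sup>2) \<le> ennreal (J * (fock_norm \<alpha> m f)\<^sup>2)"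
      using sq_norm_weighted_comp_le[OF psi phi fh] J(2)
      unfolding sq_norm_eq_fock_norm[OF maps[OF f]] sq_norm_eq_fock_norm[OF f] J(1)
      by (simp add: ennreal_mult)
    hence "(fock_norm \<alpha> m (?T f))\<^sup>2 \<le> J * (fock_norm \<alpha> m f)\<^sup>2"
      using J(2) by (subst (asm) ennreal_le_iff) auto
    thus "(fock_norm \<alpha> m (?T f))\<^sup>2 \<le> (sqrt J * fock_norm \<alpha> m f)\<^sup>2"
      using J(2) by (simp add: power_mult_distrib)
    show "0 \<le> sqrt J * fock_norm \<alpha> m f" using J(2) by (simp add: fock_norm_def)
  qed
  have "fock_bounded_operator \<alpha> m ?T"
    unfolding fock_bounded_operator_def
  proof (intro conjI ballI allI exI)
    show "?T (\<lambda>z. a * f z + b * g z) = (\<lambda>z. a * ?T f z + b * ?T g z)" for f g a b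
      by (simp add: weighted_comp_def fun_eq_iff algebra_simps)
  qed (use maps bounded in auto)
  moreover have "summable (\<lambda>n. (fock_norm \<alpha> m (?T (monomial n)))\<^sup>2)"
  proof (rule summable_suminf_not_top)
    have "monomial n \<in> fock_space \<alpha> m" for n
      using fock_onb_monomial by (simp add: fock_onb_def)
    hence "ennreal ((fock_norm \<alpha> m (?T (monomial n)))\<^sup>2) = sq_norm (?T (monomial n))" for n
      by (simp only: sq_norm_eq_fock_norm[OF maps])
    thus "(\<Sum>n. ennreal ((fock_norm \<alpha> m (?T (monomial n)))\<^sup>2)) \<noteq> top"
      using fin hs_integral_eq_suminf[OF psi phi] by simp
  qed simp
  ultimately show ?thesis
    unfolding fock_hilbert_schmidt_def using fock_onb_monomial by blast
qed

text \<open>The basis here is arbitrary, so the kernel is bounded through \<open>kernel_le_onb\<close>.\<close>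

lemma hs_integral_finite_if_hilbert_schmidt:
  assumes psi: "\<psi> holomorphic_on UNIV" and phi: "\<phi> holomorphic_on UNIV"
    and hs: "fock_hilbert_schmidt \<alpha> m (weighted_comp \<psi> \<phi>)"
  shows "hs_integral \<psi> \<phi> < \<infinity>"
proof -
  let ?T = "weighted_comp \<psi> \<phi>"
  obtain e where onb: "fock_onb \<alpha> m e" and summ: "summable (\<lambda>n. (fock_norm \<alpha> m (?T (e n)))\<^sup>2)"
    and maps: "\<And>f. f \<in> fock_space \<alpha> m \<Longrightarrow> ?T f \<in> fock_space \<alpha> m"
    using hs by (auto simp: fock_hilbert_schmidt_def fock_bounded_operator_def)
  have eF: "e n \<in> fock_space \<alpha> m" for n using onb by (simp add: fock_onb_def)
  have [measurable]: "?T (e n) \<in> borel_measurable borel" for n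
    using maps[OF eF[of n]] by (intro holomorphic_measurable) (simp add: mem_fock_space_iff)
  have "hs_integral \<psi> \<phi> \<le> (\<integral>\<^sup>+ z. 4 * (\<Sum>n. ennreal ((cmod (?T (e n) z))\<^sup>2)) \<partial>\<mu>)"
    unfolding hs_integral_def
  proof (rule nn_integral_mono)
    fix z
    have "ennreal ((cmod (\<psi> z))\<^sup>2) * kernel (cmod (\<phi> z)) \<le>
        ennreal ((cmod (\<psi> z))\<^sup>2) * (4 * (\<Sum>n. ennreal ((cmod (e n (\<phi> z)))\<^sup>2)))"
      by (intro mult_left_mono kernel_le_onb onb) auto
    also have "\<dots> = 4 * (\<Sum>n. ennreal ((cmod (\<psi> z))\<^sup>2) * ennreal ((cmod (e n (\<phi> z)))\<^sup>2))"
      by (simp add: mult.left_commute)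
    also have "\<dots> = 4 * (\<Sum>n. ennreal ((cmod (?T (e n) z))\<^sup>2))"
      by (simp add: weighted_comp_def norm_mult power_mult_distrib ennreal_mult')
    finally show "ennreal ((cmod (\<psi> z))\<^sup>2) * kernel (cmod (\<phi> z)) \<le> \<dots>" .
  qed
  also have "\<dots> = 4 * (\<Sum>n. sq_norm (?T (e n)))"
    unfolding sq_norm_def by (subst nn_integral_cmult; (subst nn_integral_suminf)?) simp_all
  also have "\<dots> = 4 * (\<Sum>n. ennreal ((fock_norm \<alpha> m (?T (e n)))\<^sup>2))"
    by (simp only: sq_norm_eq_fock_norm[OF maps[OF eF]])
  also have "\<dots> < \<infinity>"
    using summ by (simp add: suminf_ennreal2 ennreal_mult_less_top)
  finally show ?thesis .
qed

text \<open>Bound every image of a basis monomial at \<open>z\<close> by its norm and the kernel at \<open>z\<close>, and add up.\<close>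

lemma weighted_kernel_le_hs_integral:
  assumes psi: "\<psi> holomorphic_on UNIV" and phi: "\<phi> holomorphic_on UNIV"
  shows "ennreal ((cmod (\<psi> z))\<^sup>2) * kernel (cmod (\<phi> z)) \<le> hs_integral \<psi> \<phi> * kernel (cmod z)"
proof -
  have "ennreal ((cmod (\<psi> z))\<^sup>2) * kernel (cmod (\<phi> z)) \<le>
      (\<Sum>n. sq_norm (weighted_comp \<psi> \<phi> (monomial n)) * kernel (cmod z))"
    unfolding suminf_weighted_comp_monomial[symmetric]
    by (intro suminf_le summableI cmod_sq_le_kernel holomorphic_weighted_comp psi phi holomorphic_monomial)
  also have "\<dots> = hs_integral \<psi> \<phi> * kernel (cmod z)"
    unfolding hs_integral_eq_suminf[OF psi phi] by simp
  finally show ?thesis .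
qed

text \<open>The pointwise bound, with the crude exponential bounds on the kernel on both sides, is the hypothesis
of the affinity criterion for \<open>\<psi>\<^sup>2\<close> and \<open>\<phi>\<close>.\<close>

lemma affine_if_hs_integral_finite:
  assumes psi: "\<psi> holomorphic_on UNIV" and phi: "\<phi> holomorphic_on UNIV"
    and fin: "hs_integral \<psi> \<phi> < \<infinity>" and nz: "\<psi> z1 \<noteq> 0"
  shows "\<phi> z = \<phi> 0 + deriv \<phi> 0 * z"
proof -
  define J where "J = enn2real (hs_integral \<psi> \<phi>)"
  have J: "hs_integral \<psi> \<phi> = ennreal J" "J \<ge> 0" using fin by (auto simp: J_def)
  obtain C where C: "C > 0" "\<And>x. x \<ge> 0 \<Longrightarrow> kernel x \<le> ennreal (C * exp (2 * \<alpha> * x powr m))"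
    by (rule kernel_crude_upper) blast
  obtain D where D: "D > 0" "\<And>x. x \<ge> 0 \<Longrightarrow> ennreal (exp (\<alpha> / 2 * x powr m)) \<le> ennreal D * kernel x"
    by (rule kernel_crude_lower) blast
  have bound: "cmod ((\<psi> z)\<^sup>2) * exp (\<alpha> / 2 * cmod (\<phi> z) powr m) \<le> (D * J * C) * exp (2 * \<alpha> * cmod z powr m)" for z
  proof -
    have "ennreal ((cmod (\<psi> z))\<^sup>2 * exp (\<alpha> / 2 * cmod (\<phi> z) powr m)) =
        ennreal ((cmod (\<psi> z))\<^sup>2) * ennreal (exp (\<alpha> / 2 * cmod (\<phi> z) powr m))"
      by (rule ennreal_mult') simp
    also have "\<dots> \<le> ennreal ((cmod (\<psi> z))\<^sup>2) * (ennreal D * kernel (cmod (\<phi> z)))"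
      by (intro mult_left_mono D(2)) auto
    also have "\<dots> = ennreal D * (ennreal ((cmod (\<psi> z))\<^sup>2) * kernel (cmod (\<phi> z)))"
      by (simp only: mult_ac)
    also have "\<dots> \<le> ennreal D * (ennreal J * kernel (cmod z))"
      using weighted_kernel_le_hs_integral[OF psi phi, of z] unfolding J(1) by (rule mult_left_mono) simp
    also have "\<dots> \<le> ennreal D * (ennreal J * ennreal (C * exp (2 * \<alpha> * cmod z powr m)))"
      by (intro mult_left_mono C(2)) auto
    also have "\<dots> = ennreal ((D * J * C) * exp (2 * \<alpha> * cmod z powr m))"
      using D(1) J(2) C(1) by (simp add: ennreal_mult[symmetric] mult.assoc)
    finally show ?thesis
      using D(1) J(2) C(1) by (subst (asm) ennreal_le_iff) (auto simp: norm_power)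
  qed
  show ?thesis
  proof (rule entire_affine_of_exp_bound[OF _ phi _ m bound])
    show "(\<lambda>z. (\<psi> z)\<^sup>2) holomorphic_on UNIV" by (intro holomorphic_intros psi)
    show "\<alpha> / 2 > 0" using \<alpha> by simp
    show "(\<psi> z1)\<^sup>2 \<noteq> 0" using nz by simp
  qed
qed

section \<open>Replacing the kernel by its growth\<close>

definition growth_integral :: "(complex \<Rightarrow> complex) \<Rightarrow> (complex \<Rightarrow> complex) \<Rightarrow> ennreal" where
  "growth_integral \<psi> \<phi> = (\<integral>\<^sup>+ z. ennreal ((cmod (\<psi> z))\<^sup>2 * growth (cmod (\<phi> z))) \<partial>\<mu>)"

lemma growth_measurable [measurable]: "growth \<in> borel_measurable borel"
  unfolding growth_def by measurable

text \<open>The factor \<open>exp (- \<alpha> |z|\<^sup>m)\<close> is the weight of the measure up to a constant.\<close>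

lemma growth_integral_finite_iff:
  assumes psi: "\<psi> holomorphic_on UNIV" and phi: "\<phi> holomorphic_on UNIV"
  shows "growth_integral \<psi> \<phi> < \<infinity> \<longleftrightarrow>
    (\<integral>\<^sup>+ z. ennreal ((cmod (\<psi> z))\<^sup>2 * cmod (\<phi> z) powr (m - 2) *
        exp (\<alpha> * (cmod (\<phi> z) powr m - cmod z powr m))) \<partial>lborel) < \<infinity>"
    (is "_ \<longleftrightarrow> ?I < \<infinity>")
proof -
  note [measurable] = assms[THEN holomorphic_measurable]
  let ?K = "weight 0"
  have K: "?K > 0" by (rule weight_pos)
  have w: "weight z = ?K * exp (- \<alpha> * cmod z powr m)" for z by (simp add: weight_def)
  have "growth_integral \<psi> \<phi> = (\<integral>\<^sup>+ z. ennreal (weight z) * ennreal ((cmod (\<psi> z))\<^sup>2 * growth (cmod (\<phi> z))) \<partial>lborel)"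
    unfolding growth_integral_def by (rule nn_integral_fock) simp
  also have "\<dots> = (\<integral>\<^sup>+ z. ennreal ?K * ennreal ((cmod (\<psi> z))\<^sup>2 * cmod (\<phi> z) powr (m - 2) *
        exp (\<alpha> * (cmod (\<phi> z) powr m - cmod z powr m))) \<partial>lborel)"
  proof (rule nn_integral_cong)
    fix z
    have "exp (\<alpha> * (cmod (\<phi> z) powr m - cmod z powr m)) = exp (\<alpha> * cmod (\<phi> z) powr m) * exp (- \<alpha> * cmod z powr m)"
      by (simp add: exp_add[symmetric] right_diff_distrib)
    hence "weight z * ((cmod (\<psi> z))\<^sup>2 * growth (cmod (\<phi> z))) = ?K * ((cmod (\<psi> z))\<^sup>2 * cmod (\<phi> z) powr (m - 2) *
        exp (\<alpha> * (cmod (\<phi> z) powr m - cmod z powr m)))"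
      unfolding w[of z] growth_def by (simp only: mult_ac)
    thus "ennreal (weight z) * ennreal ((cmod (\<psi> z))\<^sup>2 * growth (cmod (\<phi> z))) =
       ennreal ?K * ennreal ((cmod (\<psi> z))\<^sup>2 * cmod (\<phi> z) powr (m - 2) *
        exp (\<alpha> * (cmod (\<phi> z) powr m - cmod z powr m)))"
      using weight_pos[of z] K by (subst (1 2) ennreal_mult'[symmetric]) (auto simp: less_imp_le)
  qed
  also have "\<dots> = ennreal ?K * ?I"
    by (rule nn_integral_cmult) simp
  finally show ?thesis using K by (auto simp: ennreal_mult_less_top)
qed

text \<open>Where \<open>|\<phi>|\<close> is below the threshold the kernel is bounded, and \<open>\<psi>\<close> is square integrable.\<close>

lemma hs_integral_finite_if_growth:
  assumes psi: "\<psi> \<in> fock_space \<alpha> m" and phi: "\<phi> holomorphic_on UNIV"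
    and fin: "growth_integral \<psi> \<phi> < \<infinity>"
  shows "hs_integral \<psi> \<phi> < \<infinity>"
proof -
  have psih: "\<psi> holomorphic_on UNIV" and psin: "sq_norm \<psi> < \<infinity>"
    using psi by (auto simp: mem_fock_space_iff)
  note [measurable] = psih[THEN holomorphic_measurable] phi[THEN holomorphic_measurable]
  obtain C where C: "C > 0" "\<And>x. x \<ge> 0 \<Longrightarrow> \<alpha> * x powr m \<ge> 1 \<Longrightarrow> kernel x \<le> ennreal (C * growth x)"
    by (rule kernel_comparable_growth) blast
  have "hs_integral \<psi> \<phi> \<le> (\<integral>\<^sup>+ z. ennreal C * ennreal ((cmod (\<psi> z))\<^sup>2 * growth (cmod (\<phi> z)))
      + kernel threshold * ennreal ((cmod (\<psi> z))\<^sup>2) \<partial>\<mu>)"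
    unfolding hs_integral_def
  proof (rule nn_integral_mono)
    fix z
    let ?A = "ennreal C * ennreal ((cmod (\<psi> z))\<^sup>2 * growth (cmod (\<phi> z)))"
    let ?B = "kernel threshold * ennreal ((cmod (\<psi> z))\<^sup>2)"
    show "ennreal ((cmod (\<psi> z))\<^sup>2) * kernel (cmod (\<phi> z)) \<le> ?A + ?B"
    proof (cases "cmod (\<phi> z) \<ge> threshold")
      case True
      hence "ennreal ((cmod (\<psi> z))\<^sup>2) * kernel (cmod (\<phi> z)) \<le>
          ennreal ((cmod (\<psi> z))\<^sup>2) * ennreal (C * growth (cmod (\<phi> z)))"
        by (intro mult_left_mono C(2)) (auto simp: threshold_iff)
      also have "\<dots> = ?A"
        using C(1) by (simp add: ennreal_mult mult_ac)
      also have "\<dots> \<le> ?A + ?B" by simp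
      finally show ?thesis .
    next
      case False
      hence "ennreal ((cmod (\<psi> z))\<^sup>2) * kernel (cmod (\<phi> z)) \<le> ennreal ((cmod (\<psi> z))\<^sup>2) * kernel threshold"
        by (intro mult_left_mono kernel_mono) auto
      also have "\<dots> = ?B" by (rule mult.commute)
      also have "\<dots> \<le> ?A + ?B" by simp
      finally show ?thesis .
    qed
  qed
  also have "\<dots> = ennreal C * growth_integral \<psi> \<phi> + kernel threshold * sq_norm \<psi>"
    unfolding growth_integral_def sq_norm_def by (simp add: nn_integral_add nn_integral_cmult)
  also have "\<dots> < \<infinity>"
    using fin psin kernel_finite[of threshold] threshold_pos by (simp add: ennreal_mult_less_top)
  finally show ?thesis .
qed

text \<open>The exponential factor is near 1 close to the zero of \<open>b + a z\<close> and makes the integral over the whole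
plane an explicit Gamma value after an affine substitution, so local integrability of
\<open>|b + a z|\<^bsup>m-2\<^esup>\<close> can be read off.\<close>

lemma nn_integral_affine_powr_exp_finite:
  fixes a b :: complex
  assumes a: "a \<noteq> 0"
  shows "(\<integral>\<^sup>+ z. ennreal (cmod (b + a * z) powr (m - 2) * exp (- \<alpha> * cmod (b + a * z) powr m)) \<partial>lborel) < \<infinity>"
proof -
  let ?u = "\<lambda>w. ennreal (cmod (a * w) powr (m - 2) * exp (- \<alpha> * cmod (a * w) powr m))"
  have "b + a * z = a * (b / a + z)" for z using a by (simp add: field_simps)
  hence "(\<integral>\<^sup>+ z. ennreal (cmod (b + a * z) powr (m - 2) * exp (- \<alpha> * cmod (b + a * z) powr m)) \<partial>lborel) =
      (\<integral>\<^sup>+ z. ?u (b / a + z) \<partial>lborel)" by simp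
  also have "\<dots> = (\<integral>\<^sup>+ z. ?u z \<partial>distr lborel borel ((+) (b / a)))"
    by (subst nn_integral_distr) simp_all
  also have "\<dots> = (\<integral>\<^sup>+ z. ?u z \<partial>lborel)" by (simp only: lborel_distr_plus)
  also have "\<dots> = (\<integral>\<^sup>+ z. ennreal (cmod a powr (m - 2)) *
      ennreal (cmod z powr (m - 2) * exp (- (\<alpha> * cmod a powr m) * cmod z powr m)) \<partial>lborel)"
    by (intro nn_integral_cong) (simp add: norm_mult powr_mult ennreal_mult'[symmetric] mult_ac)
  also have "\<dots> = ennreal (cmod a powr (m - 2)) * (\<integral>\<^sup>+ (z::complex).
      ennreal (cmod z powr (m - 2) * exp (- (\<alpha> * cmod a powr m) * cmod z powr m)) \<partial>lborel)"
    by (rule nn_integral_cmult) simp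
  also have "\<dots> < \<infinity>"
  proof -
    have "\<alpha> * cmod a powr m > 0" "m - 2 > -2" using \<alpha> m a by auto
    from nn_integral_cmod_powr_exp[OF this(1) m this(2)] show ?thesis
      by (simp add: ennreal_mult_less_top)
  qed
  finally show ?thesis .
qed

text \<open>Above the threshold the kernel dominates its growth. Below it, if \<open>\<psi>\<close> is not identically zero,
\<open>\<phi>\<close> is affine. If it is constant, the growth is a constant factor. Otherwise the points with
\<open>|\<phi>|\<close> below the threshold form a disc, on which \<open>\<psi>\<close> is bounded and \<open>|\<phi>|\<^bsup>m-2\<^esup>\<close> is integrable.\<close>

lemma growth_integral_finite_if_hs:
  assumes psi: "\<psi> \<in> fock_space \<alpha> m" and phi: "\<phi> holomorphic_on UNIV"
    and fin: "hs_integral \<psi> \<phi> < \<infinity>"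
  shows "growth_integral \<psi> \<phi> < \<infinity>"
proof (cases "\<forall>z. \<psi> z = 0")
  case True
  thus ?thesis by (simp add: growth_integral_def)
next
  case False
  have psih: "\<psi> holomorphic_on UNIV" and psin: "sq_norm \<psi> < \<infinity>"
    using psi by (auto simp: mem_fock_space_iff)
  note [measurable] = psih[THEN holomorphic_measurable] phi[THEN holomorphic_measurable]
  define a where "a = deriv \<phi> 0"
  define b where "b = \<phi> 0"
  have aff: "\<phi> z = b + a * z" for z
    using False affine_if_hs_integral_finite[OF psih phi fin] by (auto simp: a_def b_def)
  show ?thesis
  proof (cases "a = 0")
    case True
    have "growth_integral \<psi> \<phi> = (\<integral>\<^sup>+ z. ennreal ((cmod (\<psi> z))\<^sup>2) * ennreal (growth (cmod b)) \<partial>\<mu>)"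
      unfolding growth_integral_def by (intro nn_integral_cong) (simp add: aff True ennreal_mult')
    also have "\<dots> = sq_norm \<psi> * ennreal (growth (cmod b))"
      unfolding sq_norm_def by (rule nn_integral_multc) simp
    also have "\<dots> < \<infinity>" using psin by (simp add: ennreal_mult_less_top)
    finally show ?thesis .
  next
    case False
    obtain C where C: "C > 0" "\<And>x. x \<ge> 0 \<Longrightarrow> \<alpha> * x powr m \<ge> 1 \<Longrightarrow> ennreal (growth x) \<le> ennreal C * kernel x"
      by (rule kernel_comparable_growth) blast
    define u where "u z = cmod (\<phi> z) powr (m - 2) * exp (- \<alpha> * cmod (\<phi> z) powr m)" for z
    have [measurable]: "u \<in> borel_measurable borel" unfolding u_def by measurable
    have ufin: "(\<integral>\<^sup>+ z. ennreal (u z) \<partial>\<mu>) < \<infinity>"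
    proof -
      have "(\<integral>\<^sup>+ z. ennreal (u z) \<partial>\<mu>) = (\<integral>\<^sup>+ z. ennreal (weight z) * ennreal (u z) \<partial>lborel)"
        by (rule nn_integral_fock) simp
      also have "\<dots> \<le> (\<integral>\<^sup>+ z. ennreal (weight 0) * ennreal (u z) \<partial>lborel)"
      proof (intro nn_integral_mono mult_right_mono ennreal_leI)
        show "weight z \<le> weight 0" for z
          unfolding weight_def using m \<alpha> Gamma_2_over_m_pos by (intro mult_left_mono) auto
      qed auto
      also have "\<dots> = ennreal (weight 0) * (\<integral>\<^sup>+ z. ennreal (u z) \<partial>lborel)"
        by (rule nn_integral_cmult) simp
      also have "\<dots> < \<infinity>"
        using nn_integral_affine_powr_exp_finite[OF False, of b]
        by (simp add: u_def aff ennreal_mult_less_top)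
      finally show ?thesis .
    qed
    define \<rho> where "\<rho> = (threshold + cmod b) / cmod a"
    have "compact (\<psi> ` cball 0 \<rho>)"
      by (intro compact_continuous_image holomorphic_on_imp_continuous_on holomorphic_on_subset[OF psih]) auto
    then obtain M where M: "\<And>z. cmod z \<le> \<rho> \<Longrightarrow> cmod (\<psi> z) \<le> M"
      by (force simp: bounded_iff dest!: compact_imp_bounded)
    \<comment> \<open>below the threshold \<open>\<alpha> |\<phi> z|\<^sup>m \<le> 1\<close>, so reversing the sign in the exponent costs at most a factor \<open>exp 2\<close>\<close>
    have small: "(cmod (\<psi> z))\<^sup>2 * growth (cmod (\<phi> z)) \<le> M\<^sup>2 * exp 2 * u z" if z: "cmod (\<phi> z) < threshold" for z
    proof -
      have "cmod a * cmod z \<le> cmod (\<phi> z) + cmod b"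
        using norm_triangle_ineq4[of "\<phi> z" b] by (simp add: aff norm_mult)
      hence "cmod z \<le> \<rho>" using z False by (simp add: \<rho>_def field_simps)
      hence 1: "(cmod (\<psi> z))\<^sup>2 \<le> M\<^sup>2" by (intro power_mono M) auto
      have "\<alpha> * cmod (\<phi> z) powr m \<le> 1" using z threshold_iff[of "cmod (\<phi> z)"] by simp
      hence "exp (\<alpha> * cmod (\<phi> z) powr m) \<le> exp (2 + - \<alpha> * cmod (\<phi> z) powr m)" by simp
      also have "\<dots> = exp 2 * exp (- \<alpha> * cmod (\<phi> z) powr m)" by (rule exp_add)
      finally have "growth (cmod (\<phi> z)) \<le> cmod (\<phi> z) powr (m - 2) * (exp 2 * exp (- \<alpha> * cmod (\<phi> z) powr m))"
        unfolding growth_def by (intro mult_left_mono) auto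
      hence 2: "growth (cmod (\<phi> z)) \<le> exp 2 * u z" by (simp add: u_def mult_ac)
      have "(cmod (\<psi> z))\<^sup>2 * growth (cmod (\<phi> z)) \<le> M\<^sup>2 * (exp 2 * u z)"
        by (intro mult_mono 1 2) auto
      thus ?thesis by (simp add: mult.assoc)
    qed
    have "growth_integral \<psi> \<phi> \<le> (\<integral>\<^sup>+ z. ennreal C * (ennreal ((cmod (\<psi> z))\<^sup>2) * kernel (cmod (\<phi> z)))
        + ennreal (M\<^sup>2 * exp 2) * ennreal (u z) \<partial>\<mu>)"
      unfolding growth_integral_def
    proof (rule nn_integral_mono)
      fix z
      let ?A = "ennreal C * (ennreal ((cmod (\<psi> z))\<^sup>2) * kernel (cmod (\<phi> z)))"
      let ?B = "ennreal (M\<^sup>2 * exp 2) * ennreal (u z)"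
      show "ennreal ((cmod (\<psi> z))\<^sup>2 * growth (cmod (\<phi> z))) \<le> ?A + ?B"
      proof (cases "cmod (\<phi> z) \<ge> threshold")
        case True
        have "ennreal ((cmod (\<psi> z))\<^sup>2 * growth (cmod (\<phi> z))) =
            ennreal ((cmod (\<psi> z))\<^sup>2) * ennreal (growth (cmod (\<phi> z)))" by (simp add: ennreal_mult')
        also have "\<dots> \<le> ennreal ((cmod (\<psi> z))\<^sup>2) * (ennreal C * kernel (cmod (\<phi> z)))"
          using True by (intro mult_left_mono C(2)) (auto simp: threshold_iff)
        also have "\<dots> = ?A" by (simp only: mult_ac)
        also have "\<dots> \<le> ?A + ?B" by simp
        finally show ?thesis .
      next
        case False
        hence "ennreal ((cmod (\<psi> z))\<^sup>2 * growth (cmod (\<phi> z))) \<le> ennreal (M\<^sup>2 * exp 2 * u z)"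
          by (intro ennreal_leI small) simp
        also have "\<dots> = ?B" by (rule ennreal_mult') simp
        also have "\<dots> \<le> ?A + ?B" by simp
        finally show ?thesis .
      qed
    qed
    also have "\<dots> = ennreal C * hs_integral \<psi> \<phi> + ennreal (M\<^sup>2 * exp 2) * (\<integral>\<^sup>+ z. ennreal (u z) \<partial>\<mu>)"
      unfolding hs_integral_def by (simp add: nn_integral_add nn_integral_cmult)
    also have "\<dots> < \<infinity>" using fin ufin by (simp add: ennreal_mult_less_top)
    finally show ?thesis .
  qed
qed

end

theorem theorem1p4:
  fixes m \<alpha> :: real and \<psi> \<phi> :: "complex \<Rightarrow> complex"
  assumes "m > 0" and "\<alpha> > 0"
    and "\<psi> \<in> fock_space \<alpha> m"
    and "\<phi> holomorphic_on UNIV"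
  shows "fock_hilbert_schmidt \<alpha> m (weighted_comp \<psi> \<phi>) \<longleftrightarrow>
    (\<integral>\<^sup>+ z. ennreal ((cmod (\<psi> z))\<^sup>2 * cmod (\<phi> z) powr (m - 2) *
        exp (\<alpha> * (cmod (\<phi> z) powr m - cmod z powr m))) \<partial>lborel) < \<infinity>"
proof -
  interpret fock_parameters \<alpha> m by standard (use assms in auto)
  have psi: "\<psi> holomorphic_on UNIV" using assms(3) by (simp add: fock_space_def)
  have "fock_hilbert_schmidt \<alpha> m (weighted_comp \<psi> \<phi>) \<longleftrightarrow> hs_integral \<psi> \<phi> < \<infinity>"
    using hilbert_schmidt_if_hs_integral_finite[OF psi assms(4)]
      hs_integral_finite_if_hilbert_schmidt[OF psi assms(4)] by blast
  also have "\<dots> \<longleftrightarrow> growth_integral \<psi> \<phi> < \<infinity>"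
    using hs_integral_finite_if_growth[OF assms(3,4)] growth_integral_finite_if_hs[OF assms(3,4)] by blast
  finally show ?thesis using growth_integral_finite_iff[OF psi assms(4)] by simp
qed

end
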